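(* Let $Q=T[H_1,\dots,H_t]$ be a strong semicomplete composition of order $n$, let $k\in\{1,\dots,n\}$, and for each $i\in\{1,\dots,t\}$ let $\ell_{i,k}$ denote the maximum number of vertices of $H_i$ that can be covered by a $k$-path subdigraph in $Q$. Then every maximum $k$-path subdigraph in $Q$ covers exactly $\ell_{i,k}$ vertices of $H_i$ for each $i\in\{1,\dots,t\}$.
   Context: Digraphs are finite, without loops or parallel arcs (2-cycles are allowed); paths are directed, and a single vertex is a path. A digraph is semicomplete if there is at least one arc between every pair of distinct vertices. Let $T$ be a digraph with vertices $u_1,\dots,u_t$ ($t\ge 2$) and let $H_1,\dots,H_t$ be pairwise disjoint nonempty digraphs. The composition $Q=T[H_1,\dots,H_t]$ is the digraph with vertex set $\bigcup_i V(H_i)$ and arc set $\bigcup_{i=1}^t A(H_i)\cup\{xy : x\in V(H_i),\ y\in V(H_p),\ u_iu_p\in A(T)\}$. It is a semicomplete composition if $T$ is semicomplete. A digraph is strong if for every ordered pair of vertices $(x,y)$ there is a directed path from $x$ to $y$. A $k$-path subdigraph of a digraph $D$ is a collection of $k$ pairwise vertex-disjoint paths of $D$. A maximum $k$-path subdigraph is a $k$-path subdigraph covering the maximum number of vertices among all $k$-path subdigraphs of $D$. *)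

theory Defs
  imports "Graph_Theory.Graph_Theory" "HOL-Library.Disjoint_Sets"
begin

definition semicomplete :: "'a pair_pre_digraph \<Rightarrow> bool" where
  "semicomplete D \<longleftrightarrow>
     (\<forall>x\<in>pverts D. \<forall>y\<in>pverts D. x \<noteq> y \<longrightarrow> (x, y) \<in> parcs D \<or> (y, x) \<in> parcs D)"

text \<open>The composition \<open>T[H\<^sub>1, \<dots>, H\<^sub>t]\<close>, where \<open>u 1, \<dots>, u t\<close> enumerates the vertices of \<open>T\<close>.\<close>

definition composition ::
  "'b pair_pre_digraph \<Rightarrow> (nat \<Rightarrow> 'b) \<Rightarrow> nat \<Rightarrow> (nat \<Rightarrow> 'a pair_pre_digraph) \<Rightarrow> 'a pair_pre_digraph" where
  "composition T u t H =
     \<lparr> pverts = (\<Union>i\<in>{1..t}. pverts (H i)),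
       parcs = (\<Union>i\<in>{1..t}. parcs (H i)) \<union>
         {(x, y). \<exists>i\<in>{1..t}. \<exists>p\<in>{1..t}.
            x \<in> pverts (H i) \<and> y \<in> pverts (H p) \<and> (u i, u p) \<in> parcs T} \<rparr>"

text \<open>
  A path is a nonempty list of distinct vertices whose consecutive entries are joined by arcs;
  as there are no parallel arcs, the list determines the path.
\<close>

definition k_path_subdigraph :: "nat \<Rightarrow> 'a pair_pre_digraph \<Rightarrow> 'a list set \<Rightarrow> bool" where
  "k_path_subdigraph k D P \<longleftrightarrow>
     finite P \<and> card P = k \<and> (\<forall>p\<in>P. vpath p (with_proj D)) \<and>
     pairwise (\<lambda>p q. disjnt (set p) (set q)) P"

definition covered :: "'a list set \<Rightarrow> 'a set" where
  "covered P = (\<Union>p\<in>P. set p)"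

definition maximum_k_path_subdigraph :: "nat \<Rightarrow> 'a pair_pre_digraph \<Rightarrow> 'a list set \<Rightarrow> bool" where
  "maximum_k_path_subdigraph k D P \<longleftrightarrow>
     k_path_subdigraph k D P \<and>
     (\<forall>P'. k_path_subdigraph k D P' \<longrightarrow> card (covered P') \<le> card (covered P))"

text \<open>
  The maximum number of vertices of \<open>W\<close> that a \<open>k\<close>-path subdigraph of \<open>D\<close> can cover.
  For finite \<open>D\<close> and \<open>k \<le> card (pverts D)\<close> the maximum is over a finite nonempty set,
  as the next two lemmas show.
\<close>

definition max_cover :: "nat \<Rightarrow> 'a pair_pre_digraph \<Rightarrow> 'a set \<Rightarrow> nat" where
  "max_cover k D W = Max {card (covered P \<inter> W) | P. k_path_subdigraph k D P}"

lemma finite_max_cover_set: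
  assumes "finite (pverts D)"
  shows "finite {card (covered P \<inter> W) | P. k_path_subdigraph k D P}"
proof (rule finite_subset)
  show "{card (covered P \<inter> W) | P. k_path_subdigraph k D P} \<subseteq> {..card (pverts D)}"
  proof clarsimp
    fix P assume "k_path_subdigraph k D P"
    then have "covered P \<inter> W \<subseteq> pverts D"
      by (auto simp: k_path_subdigraph_def covered_def vpath_def vwalk_def)
    then show "card (covered P \<inter> W) \<le> card (pverts D)"
      using assms by (rule card_mono[rotated])
  qed
qed simp

lemma max_cover_set_nonempty:
  assumes "k \<le> card (pverts D)"
  shows "{card (covered P \<inter> W) | P. k_path_subdigraph k D P} \<noteq> {}"
proof -
  obtain S where S: "S \<subseteq> pverts D" "card S = k" "finite S"
    using obtain_subset_with_card_n[OF assms] by blast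
  have "card ((\<lambda>x. [x]) ` S) = k"
    using S by (subst card_image) (auto simp: inj_on_def)
  with S have "k_path_subdigraph k D ((\<lambda>x. [x]) ` S)"
    by (auto simp: k_path_subdigraph_def vpath_def vwalk_def pairwise_def disjnt_def)
  then show ?thesis by blast
qed

end

theory Submission
  imports Defs "HOL-Library.Multiset"
begin

text \<open>
  Only two properties of \<open>W = V(H\<^sub>i)\<close> matter: its vertices have the same neighbours outside \<open>W\<close>,
  and each of them is adjacent to every vertex outside \<open>W\<close>. Let \<open>P\<close> be a maximum \<open>k\<close>-path
  subdigraph missing some \<open>x \<in> W\<close>, and let \<open>S\<close>, \<open>R\<close>, \<open>B\<close> be the sets of vertices outside \<open>W\<close> that
  are joined to \<open>W\<close> only by arcs from \<open>W\<close>, only by arcs to \<open>W\<close>, and by arcs in both directions.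
  As \<open>x\<close> cannot be inserted into \<open>P\<close>, each path of \<open>P\<close> has the form
  \<open>R* w (S* t R* w)* S*\<close>, where \<open>w\<close> is a subpath inside \<open>W\<close> and the transition \<open>t\<close> is either a
  vertex of \<open>B\<close> or an arc from \<open>S\<close> to \<open>R\<close>, and \<open>P\<close> covers \<open>B\<close>. So \<open>P\<close> has exactly \<open>k\<close> more
  subpaths in \<open>W\<close> than transitions, while any \<open>k\<close>-path subdigraph \<open>P'\<close> has at most \<open>k\<close> more.
  If \<open>P'\<close> covers more of \<open>W\<close> than \<open>P\<close>, then either its subpaths in \<open>W\<close>, suitably cut, can replace
  those of \<open>P\<close>, or \<open>P'\<close> has more arcs from \<open>S\<close> to \<open>R\<close> than \<open>P\<close>. In the latter case the matching of
  these arcs in \<open>P\<close> can be augmented, and reassembling the pieces gives room for \<open>x\<close>.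
  Both cases contradict the maximality of \<open>P\<close>.
\<close>

subsection \<open>Path systems as linear forests\<close>

definition path_arcs :: "'a list list \<Rightarrow> 'a rel" where
  "path_arcs ps = (\<Union>p\<in>set ps. set (vwalk_arcs p))"

text \<open>A single condition on the concatenation makes every path simple and the paths pairwise
  disjoint. Lists rather than sets let the number of paths be a length and let rearranged systems be
  compared as multisets of vertices.\<close>

definition path_system :: "'a set \<Rightarrow> 'a rel \<Rightarrow> 'a list list \<Rightarrow> bool" where
  "path_system V E ps \<longleftrightarrow>
     distinct (concat ps) \<and> [] \<notin> set ps \<and> set (concat ps) \<subseteq> V \<and> path_arcs ps \<subseteq> E"

section \<open>Arcs along a single path\<close>

lemma vwalk_arcs_append_subset:
  "set (vwalk_arcs (p @ q)) \<subseteq> E \<longleftrightarrow>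
     set (vwalk_arcs p) \<subseteq> E \<and> set (vwalk_arcs q) \<subseteq> E \<and>
     (p = [] \<or> q = [] \<or> (last p, hd q) \<in> E)"
  by (cases "p = []"; cases "q = []") (auto simp: vwalk_arcs_append)

lemma in_vwalk_arcs_split:
  assumes "(y, z) \<in> set (vwalk_arcs p)"
  obtains l r where "p = l @ y # z # r"
  using assms
proof (induction p arbitrary: thesis rule: vwalk_arcs.induct)
  case (3 a b xs)
  show ?case
  proof (cases "(y, z) = (a, b)")
    case True
    then show ?thesis using "3.prems"(1)[of "[]"] by simp
  next
    case False
    with "3.prems"(2) have "(y, z) \<in> set (vwalk_arcs (b # xs))" by auto
    then obtain l r where "b # xs = l @ y # z # r" using "3.IH" by blast
    then show ?thesis using "3.prems"(1)[of "a # l"] by simp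
  qed
qed auto

lemma vwalk_arcs_in_set:
  "set (vwalk_arcs p) \<subseteq> set p \<times> set p"
  by (induction p rule: vwalk_arcs.induct) auto

lemma in_set_vwalk_arcs:
  assumes "(y, z) \<in> set (vwalk_arcs p)"
  shows "y \<in> set p" and "z \<in> set p"
  using assms vwalk_arcs_in_set[of p] by auto

lemma distinct_vwalk_arcs: "distinct p \<Longrightarrow> distinct (vwalk_arcs p)"
  by (induction p rule: vwalk_arcs.induct) (auto dest: in_set_vwalk_arcs)

lemma single_valued_vwalk_arcs: "distinct p \<Longrightarrow> single_valued (set (vwalk_arcs p))"
  by (induction p rule: vwalk_arcs.induct)
     (auto simp: single_valued_def dest: in_set_vwalk_arcs)

lemma Range_vwalk_arcs: "Range (set (vwalk_arcs p)) \<subseteq> set (tl p)"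
  by (induction p rule: vwalk_arcs.induct) auto

lemma single_valued_converse_vwalk_arcs:
  "distinct p \<Longrightarrow> single_valued ((set (vwalk_arcs p))\<inverse>)"
proof (induction p rule: vwalk_arcs.induct)
  case (3 a b xs)
  then have "b \<notin> Range (set (vwalk_arcs (b # xs)))"
    using Range_vwalk_arcs[of "b # xs"] by auto
  with 3 show ?case by (auto simp: single_valued_def)
qed (auto simp: single_valued_def)

lemma acyclic_vwalk_arcs: "distinct p \<Longrightarrow> acyclic (set (vwalk_arcs p))"
proof (induction p rule: vwalk_arcs.induct)
  case (3 a b xs)
  have "(b, a) \<notin> (set (vwalk_arcs (b # xs)))\<^sup>*"
  proof
    assume "(b, a) \<in> (set (vwalk_arcs (b # xs)))\<^sup>*"
    moreover have "a \<noteq> b" using "3.prems" by auto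
    ultimately have "a \<in> Range (set (vwalk_arcs (b # xs)))"
      by (metis Range_iff rtranclE)
    then show False using Range_vwalk_arcs[of "b # xs"] "3.prems" by auto
  qed
  then show ?case using 3 by (simp add: acyclic_insert)
qed (auto simp: acyclic_def)

section \<open>Arc sets of path systems\<close>

lemma path_arcs_subset_concat: "path_arcs ps \<subseteq> set (vwalk_arcs (concat ps))"
proof (induction ps)
  case (Cons p ps)
  have "set (vwalk_arcs p) \<union> set (vwalk_arcs (concat ps)) \<subseteq> set (vwalk_arcs (p @ concat ps))"
    using vwalk_arcs_append_subset[of p "concat ps" "set (vwalk_arcs (p @ concat ps))"] by auto
  with Cons show ?case by (auto simp: path_arcs_def)
qed (simp add: path_arcs_def)

text \<open>The concatenation of all paths is one long simple list whose arcs include those of the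
  system, and all four properties pass to subsets.\<close>

lemma path_arcs_linear_forest:
  assumes "distinct (concat ps)"
  shows "single_valued (path_arcs ps)" "single_valued ((path_arcs ps)\<inverse>)" "acyclic (path_arcs ps)"
    and "path_arcs ps \<subseteq> set (concat ps) \<times> set (concat ps)"
proof -
  note sub = path_arcs_subset_concat[of ps]
  show "single_valued (path_arcs ps)"
    using sub single_valued_vwalk_arcs[OF assms] by (rule single_valued_subset)
  show "single_valued ((path_arcs ps)\<inverse>)"
    using sub single_valued_converse_vwalk_arcs[OF assms] by (auto simp: single_valued_def)
  show "acyclic (path_arcs ps)"
    using acyclic_vwalk_arcs[OF assms] sub by (rule acyclic_subset)
  show "path_arcs ps \<subseteq> set (concat ps) \<times> set (concat ps)"
    using sub vwalk_arcs_in_set[of "concat ps"] by (rule order_trans)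
qed

lemma finite_path_arcs: "finite (path_arcs ps)"
  by (simp add: path_arcs_def)

text \<open>Together with its analogue for arcs, this allows counts made along one path to be summed
  to cardinalities for the whole system.\<close>

lemma card_concat_Int:
  assumes "distinct (concat ps)"
  shows "card (set (concat ps) \<inter> X) = (\<Sum>p\<leftarrow>ps. length (filter (\<lambda>x. x \<in> X) p))"
proof -
  have "set (concat ps) \<inter> X = set (filter (\<lambda>x. x \<in> X) (concat ps))" by auto
  also have "card \<dots> = length (filter (\<lambda>x. x \<in> X) (concat ps))"
    using assms by (intro distinct_card) (simp add: distinct_filter)
  also have "\<dots> = (\<Sum>p\<leftarrow>ps. length (filter (\<lambda>x. x \<in> X) p))"
    by (induction ps) auto
  finally show ?thesis .
qed

lemma card_path_arcs_Int:
  assumes "distinct (concat ps)"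
  shows "card (path_arcs ps \<inter> Y) = (\<Sum>p\<leftarrow>ps. length (filter (\<lambda>e. e \<in> Y) (vwalk_arcs p)))"
  using assms
proof (induction ps)
  case (Cons p ps)
  have eq: "path_arcs (p # ps) \<inter> Y = set (filter (\<lambda>e. e \<in> Y) (vwalk_arcs p)) \<union> (path_arcs ps \<inter> Y)"
    by (auto simp: path_arcs_def)
  have "set (vwalk_arcs p) \<inter> path_arcs ps = {}"
    using Cons.prems path_arcs_linear_forest(4)[of ps] vwalk_arcs_in_set[of p] by fastforce
  then have "card (path_arcs (p # ps) \<inter> Y)
      = card (set (filter (\<lambda>e. e \<in> Y) (vwalk_arcs p))) + card (path_arcs ps \<inter> Y)"
    unfolding eq by (intro card_Un_disjoint) (auto simp: finite_path_arcs)
  moreover have "card (set (filter (\<lambda>e. e \<in> Y) (vwalk_arcs p))) = length (filter (\<lambda>e. e \<in> Y) (vwalk_arcs p))"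
    using Cons.prems by (intro distinct_card) (simp add: distinct_vwalk_arcs)
  ultimately show ?case
    using Cons by simp
qed (simp add: path_arcs_def)

text \<open>A nonempty path has one vertex more than it has arcs. Hence the vertices and arcs of a
  linear forest determine how many pieces it has.\<close>

lemma length_eq_card_diff:
  assumes "distinct (concat ps)" "[] \<notin> set ps"
  shows "length ps + card (path_arcs ps) = card (set (concat ps))"
proof -
  have len: "length (vwalk_arcs p) + 1 = length p" if "p \<noteq> []" for p :: "'a list"
    using that by (induction p rule: vwalk_arcs.induct) auto
  have "length ps + (\<Sum>p\<leftarrow>ps. length (vwalk_arcs p)) = (\<Sum>p\<leftarrow>ps. length p)"
    using assms(2) by (induction ps) (auto simp: len[symmetric])
  with card_concat_Int[OF assms(1), of UNIV] card_path_arcs_Int[OF assms(1), of UNIV]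
  show ?thesis by simp
qed

lemma in_Domain_vwalk_arcs:
  "v \<in> set p \<Longrightarrow> v \<noteq> last p \<Longrightarrow> v \<in> Domain (set (vwalk_arcs p))"
proof (induction p rule: vwalk_arcs.induct)
  case (3 a b xs)
  then show ?case by (cases "v = a") (simp, simp del: vwalk_arcs_Cons)
qed auto

lemma in_Range_vwalk_arcs:
  "v \<in> set p \<Longrightarrow> v \<noteq> hd p \<Longrightarrow> v \<in> Range (set (vwalk_arcs p))"
proof (induction p rule: vwalk_arcs.induct)
  case (3 a b xs)
  then show ?case by (cases "v = b") (simp, simp del: vwalk_arcs_Cons)
qed auto

lemma not_in_Domain_path_arcs:
  assumes "v \<in> set (concat ps)" "v \<notin> Domain (path_arcs ps)"
  shows "v \<in> last ` set ps"
proof -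
  obtain p where p: "p \<in> set ps" "v \<in> set p" using assms(1) by auto
  then have "v = last p"
    using assms(2) in_Domain_vwalk_arcs[of v p] unfolding path_arcs_def by blast
  with p show ?thesis by blast
qed

lemma not_in_Range_path_arcs:
  assumes "v \<in> set (concat ps)" "v \<notin> Range (path_arcs ps)"
  shows "v \<in> hd ` set ps"
proof -
  obtain p where p: "p \<in> set ps" "v \<in> set p" using assms(1) by auto
  then have "v = hd p"
    using assms(2) in_Range_vwalk_arcs[of v p] unfolding path_arcs_def by blast
  with p show ?thesis by blast
qed

lemma last_not_in_Domain_vwalk_arcs:
  "distinct p \<Longrightarrow> last p \<notin> Domain (set (vwalk_arcs p))"
proof (induction p rule: vwalk_arcs.induct)
  case (3 a b xs)
  have "last (b # xs) \<noteq> a" using "3.prems" last_in_set[of "b # xs"] by auto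
  with 3 show ?case by (simp del: vwalk_arcs_Cons)
qed auto

lemma hd_not_in_Range_vwalk_arcs:
  "distinct p \<Longrightarrow> hd p \<notin> Range (set (vwalk_arcs p))"
  using Range_vwalk_arcs[of p] by (cases p) auto

lemma distinct_concat_in_same:
  assumes "distinct (concat ps)" "p \<in> set ps" "q \<in> set ps" "v \<in> set p" "v \<in> set q"
  shows "p = q"
  using assms by (auto simp: distinct_concat_iff)

lemma last_not_in_Domain_path_arcs:
  assumes "distinct (concat ps)" "p \<in> set ps" "p \<noteq> []"
  shows "last p \<notin> Domain (path_arcs ps)"
proof
  assume "last p \<in> Domain (path_arcs ps)"
  then obtain q where q: "q \<in> set ps" "last p \<in> Domain (set (vwalk_arcs q))"
    by (auto simp: path_arcs_def)
  then have "last p \<in> set q" using vwalk_arcs_in_set[of q] by auto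
  then have "p = q" using distinct_concat_in_same[OF assms(1,2) q(1), of "last p"] assms(3) by simp
  then show False using q last_not_in_Domain_vwalk_arcs[of q] assms by (auto simp: distinct_concat_iff)
qed

lemma hd_not_in_Range_path_arcs:
  assumes "distinct (concat ps)" "p \<in> set ps" "p \<noteq> []"
  shows "hd p \<notin> Range (path_arcs ps)"
proof
  assume "hd p \<in> Range (path_arcs ps)"
  then obtain q where q: "q \<in> set ps" "hd p \<in> Range (set (vwalk_arcs q))"
    by (auto simp: path_arcs_def)
  then have "hd p \<in> set q" using vwalk_arcs_in_set[of q] by auto
  then have "p = q" using distinct_concat_in_same[OF assms(1,2) q(1), of "hd p"] assms(3) by simp
  then show False using q hd_not_in_Range_vwalk_arcs[of q] assms by (auto simp: distinct_concat_iff)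
qed

lemma hd_last_rtrancl_vwalk_arcs:
  "p \<noteq> [] \<Longrightarrow> (hd p, last p) \<in> (set (vwalk_arcs p))\<^sup>*"
proof (induction p rule: vwalk_arcs.induct)
  case (3 a b xs)
  have "set (vwalk_arcs (b # xs)) \<subseteq> set (vwalk_arcs (a # b # xs))" by auto
  from rtrancl_mono[OF this] have "(b, last (b # xs)) \<in> (set (vwalk_arcs (a # b # xs)))\<^sup>*"
    using "3.IH" by (metis list.distinct(1) list.sel(1) subsetD)
  then show ?case by (auto intro: converse_rtrancl_into_rtrancl)
qed auto

text \<open>The arcs are added one at a time, starting from isolated vertices. For a new arc from
  \<open>x\<close> to \<open>y\<close>, single-valuedness makes \<open>x\<close> the end of a path
  and \<open>y\<close> the start of a path, and these are joined. Thus path systems can be modified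
  as relations and read off as lists afterwards.\<close>

lemma linear_forest_paths:
  assumes "finite A" "finite V" "A \<subseteq> V \<times> V" "single_valued A" "single_valued (A\<inverse>)" "acyclic A"
  obtains ps where "distinct (concat ps)" "[] \<notin> set ps" "set (concat ps) = V" "path_arcs ps = A"
  using assms
proof (induction A arbitrary: thesis rule: finite_induct)
  case empty
  obtain vs where vs: "set vs = V" "distinct vs" using finite_distinct_list[OF \<open>finite V\<close>] by blast
  have "concat (map (\<lambda>v. [v]) vs) = vs" by (induction vs) auto
  with vs show ?case by (intro empty.prems(1)[of "map (\<lambda>v. [v]) vs"]) (auto simp: path_arcs_def)
next
  case (insert e A)
  obtain x y where e: "e = (x, y)" by fastforce
  have x: "x \<notin> Domain A" and y: "y \<notin> Range A"
    using insert.hyps(2) single_valuedD[OF insert.prems(4), of x y]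
      single_valuedD[OF insert.prems(5), of y x] unfolding e by auto
  have "acyclic A" using insert.prems(6) by (rule acyclic_subset) auto
  moreover have "single_valued A" "single_valued (A\<inverse>)"
    by (rule single_valued_subset[OF _ insert.prems(4)] single_valued_subset[OF _ insert.prems(5)]; auto)+
  ultimately obtain ps where ps: "distinct (concat ps)" "[] \<notin> set ps" "set (concat ps) = V" "path_arcs ps = A"
    using insert.IH insert.prems(2,3) by blast
  have "x \<in> V" "y \<in> V" using insert.prems e by auto
  then obtain p q where p: "p \<in> set ps" "last p = x" and q: "q \<in> set ps" "hd q = y"
    using not_in_Domain_path_arcs[of x ps] not_in_Range_path_arcs[of y ps] x y ps by auto
  have ne: "p \<noteq> []" "q \<noteq> []" using p q ps by auto
  \<comment> \<open>If the two paths coincided, the path from \<open>y\<close> to \<open>x\<close>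
    and the new arc would close a cycle.\<close>
  have "p \<noteq> q"
  proof
    assume "p = q"
    then have "(y, x) \<in> (set (vwalk_arcs p))\<^sup>*"
      using hd_last_rtrancl_vwalk_arcs[of p] p q ne by auto
    moreover have "set (vwalk_arcs p) \<subseteq> A" using p ps by (auto simp: path_arcs_def)
    ultimately have "(y, x) \<in> A\<^sup>*" using rtrancl_mono by blast
    then show False using insert.prems(6) e by (simp add: acyclic_insert)
  qed
  define rest where "rest = remove1 q (remove1 p ps)"
  \<comment> \<open>The order of the paths is immaterial, so \<open>p\<close> and \<open>q\<close>
    are moved to the front up to permutation.\<close>
  have m: "mset ps = mset (p # q # rest)"
  proof -
    have rem: "mset (x # remove1 x xs) = mset xs" if "x \<in> set xs" for x :: "'a list" and xs
      using that by simp
    have "q \<in> set (remove1 p ps)" using q \<open>p \<noteq> q\<close> by simp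
    from rem[OF this] rem[OF p(1)] show ?thesis unfolding rest_def by (metis mset.simps(2))
  qed
  have setps: "set ps = set (p # q # rest)" using m by (rule mset_eq_setD)
  have "mset (concat ps) = mset (concat (p # q # rest))"
    unfolding mset_concat using m by (metis mset_map sum_mset_sum_list)
  then have mc: "mset (concat ((p @ q) # rest)) = mset (concat ps)" by simp
  show ?case
  proof (rule insert.prems(1)[of "(p @ q) # rest"])
    show "distinct (concat ((p @ q) # rest))" using mset_eq_imp_distinct_iff[OF mc] ps(1) by simp
    show "[] \<notin> set ((p @ q) # rest)" using ps setps ne by auto
    show "set (concat ((p @ q) # rest)) = V" using mset_eq_setD[OF mc] ps(3) by simp
    show "path_arcs ((p @ q) # rest) = Set.insert e A"
      unfolding ps(4)[symmetric] path_arcs_def setps e using p q ne by (auto simp: vwalk_arcs_append)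
  qed
qed

section \<open>Matchings as relations\<close>

lemma single_valued_insert:
  "single_valued A \<Longrightarrow> a \<notin> Domain A \<Longrightarrow> single_valued (insert (a, b) A)"
  by (auto simp: single_valued_def)

lemma single_valued_converse_insert:
  "single_valued (A\<inverse>) \<Longrightarrow> b \<notin> Range A \<Longrightarrow> single_valued ((insert (a, b) A)\<inverse>)"
  by (auto simp: single_valued_def)

lemma single_valued_Un_disjoint:
  assumes "single_valued A" "single_valued C" "Domain A \<inter> Domain C = {}"
  shows "single_valued (A \<union> C)"
proof (rule single_valuedI)
  fix x y z assume "(x, y) \<in> A \<union> C" "(x, z) \<in> A \<union> C"
  then show "y = z"
    using assms(3) single_valuedD[OF assms(1), of x y z] single_valuedD[OF assms(2), of x y z] by blast
qed

lemma card_Domain_single_valued: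
  assumes "single_valued A"
  shows "card (Domain A) = card A"
proof -
  have "inj_on fst A" using assms by (auto simp: inj_on_def single_valued_def)
  then show ?thesis by (simp add: Domain_fst card_image)
qed

text \<open>
  Berge's augmentation in a form that keeps all vertices covered by the smaller matching.
\<close>

lemma augment_matching:
  assumes "finite M" "finite M'" "card M < card M'"
    and "single_valued M" "single_valued (M\<inverse>)" "single_valued M'" "single_valued (M'\<inverse>)"
  obtains N a b where "N \<subseteq> M \<union> M'" "single_valued N" "single_valued (N\<inverse>)"
    "Domain N = insert a (Domain M)" "Range N = insert b (Range M)"
    "a \<in> Domain M' - Domain M" "b \<in> Range M' - Range M"
  using assms
proof (induction "card M" arbitrary: M M' thesis rule: less_induct)
  case less
  have "card (Domain M) < card (Domain M')"
    using less.prems by (simp add: card_Domain_single_valued)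
  then have "\<not> Domain M' \<subseteq> Domain M" using less.prems(2)
    by (metis card_mono finite_Domain linorder_not_less)
  then obtain a b where a: "(a, b) \<in> M'" "a \<notin> Domain M" by blast
  show ?case
  proof (cases "b \<in> Range M")
    case False
    show ?thesis
    proof (rule less.prems(1)[of "insert (a, b) M" a b])
      show "single_valued (insert (a, b) M)" "single_valued ((insert (a, b) M)\<inverse>)"
        using less.prems(5,6) a(2) False by (auto intro: single_valued_insert single_valued_converse_insert)
    qed (use a False in auto)
  next
    case True
    then obtain s where s: "(s, b) \<in> M" by blast
    \<comment> \<open>Both arcs entering \<open>b\<close> are deleted and the remaining matchings
      augmented. Then \<open>b\<close> is matched again: to \<open>a\<close> if \<open>s\<close> is
      the newly matched tail, and to its old partner \<open>s\<close> otherwise.\<close>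
    define M1 where "M1 = M - {(s, b)}"
    define M1' where "M1' = M' - {(a, b)}"
    have "card M = Suc (card M1)" "card M' = Suc (card M1')"
      unfolding M1_def M1'_def using less.prems(2,3) s a(1) by (simp_all only: card_Suc_Diff1)
    then have c: "card M1 < card M" "card M1 < card M1'"
      using less.prems(4) by auto
    have sv: "single_valued M1" "single_valued (M1\<inverse>)" "single_valued M1'" "single_valued (M1'\<inverse>)"
      by (rule single_valued_subset[OF _ less.prems(5)] single_valued_subset[OF _ less.prems(6)]
            single_valued_subset[OF _ less.prems(7)] single_valued_subset[OF _ less.prems(8)];
          auto simp: M1_def M1'_def)+
    have fin: "finite M1" "finite M1'" using less.prems(2,3) by (auto simp: M1_def M1'_def)
    obtain N c d where N: "N \<subseteq> M1 \<union> M1'" "single_valued N" "single_valued (N\<inverse>)"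
      "Domain N = insert c (Domain M1)" "Range N = insert d (Range M1)"
      "c \<in> Domain M1' - Domain M1" "d \<in> Range M1' - Range M1"
      by (rule less.hyps[OF c(1) _ fin c(2) sv])
    have M: "M = insert (s, b) M1" using s by (auto simp: M1_def)
    have DM: "Domain M = insert s (Domain M1)" and RM: "Range M = insert b (Range M1)"
      by (subst M, simp)+
    have "s \<notin> Domain M1"
      using s single_valuedD[OF less.prems(5), of s b] unfolding M1_def by blast
    moreover have "b \<notin> Range M1"
      using s single_valuedD[OF less.prems(6), of b s] unfolding M1_def by blast
    moreover have "a \<notin> Domain M1'"
      using a(1) single_valuedD[OF less.prems(7), of a b] unfolding M1'_def by blast
    moreover have "b \<notin> Range M1'"
      using a(1) single_valuedD[OF less.prems(8), of b a] unfolding M1'_def by blast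
    moreover have "Domain M1' \<subseteq> Domain M'" "Range M1' \<subseteq> Range M'" by (auto simp: M1'_def)
    ultimately have DM': "s \<notin> Domain M1" "b \<notin> Range M1" "a \<notin> Domain M1'" "b \<notin> Range M1'"
      "Domain M1' \<subseteq> Domain M'" "Range M1' \<subseteq> Range M'" by blast+
    have "b \<notin> Range N" using N(5,7) DM' by auto
    show ?thesis
    proof (cases "c = s")
      case True
      have "a \<notin> Domain N" using N(4) True DM a by auto
      show ?thesis
      proof (rule less.prems(1)[of "insert (a, b) N" a d])
        show "single_valued (insert (a, b) N)"
          using N(2) \<open>a \<notin> Domain N\<close> by (rule single_valued_insert)
        show "single_valued ((insert (a, b) N)\<inverse>)"
          using N(3) \<open>b \<notin> Range N\<close> by (rule single_valued_converse_insert)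
        show "insert (a, b) N \<subseteq> M \<union> M'" using N(1) a by (auto simp: M1_def M1'_def)
        show "Domain (insert (a, b) N) = insert a (Domain M)" using N(4) True DM by auto
        show "Range (insert (a, b) N) = insert d (Range M)" using N(5) RM by auto
        show "a \<in> Domain M' - Domain M" using a by auto
        show "d \<in> Range M' - Range M" using N(7) RM DM' by auto
      qed
    next
      case False
      have "s \<notin> Domain N" using N(4) False DM' by auto
      show ?thesis
      proof (rule less.prems(1)[of "insert (s, b) N" c d])
        show "single_valued (insert (s, b) N)"
          using N(2) \<open>s \<notin> Domain N\<close> by (rule single_valued_insert)
        show "single_valued ((insert (s, b) N)\<inverse>)"
          using N(3) \<open>b \<notin> Range N\<close> by (rule single_valued_converse_insert)
        show "insert (s, b) N \<subseteq> M \<union> M'" using N(1) s by (auto simp: M1_def M1'_def)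
        show "Domain (insert (s, b) N) = insert c (Domain M)" using N(4) DM by auto
        show "Range (insert (s, b) N) = insert d (Range M)" using N(5) RM by auto
        show "c \<in> Domain M' - Domain M" using N(6) DM DM' False by auto
        show "d \<in> Range M' - Range M" using N(7) RM DM' by auto
      qed
    qed
  qed
qed

lemma linear_forest_subset:
  assumes "single_valued A" "single_valued (A\<inverse>)" "acyclic A" "A' \<subseteq> A"
  shows "single_valued A'" "single_valued (A'\<inverse>)" "acyclic A'"
  using assms single_valued_subset[of A' A] single_valued_subset[of "A'\<inverse>" "A\<inverse>"]
  by (auto intro: acyclic_subset)

text \<open>Levels never drop along \<open>N\<close>, so a closed walk would stay on one level and
  thus be a closed walk in \<open>A\<close>.\<close>

lemma acyclic_level:
  fixes lev :: "'a \<Rightarrow> nat"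
  assumes "acyclic A"
    and step: "\<And>x y. (x, y) \<in> N \<Longrightarrow> lev x < lev y \<or> lev x = lev y \<and> (x, y) \<in> A"
  shows "acyclic N"
proof -
  have "lev x < lev y \<or> lev x = lev y \<and> (x, y) \<in> A\<^sup>+" if "(x, y) \<in> N\<^sup>+" for x y
    using that
  proof induction
    case (base y)
    then show ?case using step by blast
  next
    case (step y z)
    then show ?case using assms(2)[of y z] by (auto intro: trancl_into_trancl)
  qed
  then show ?thesis using assms(1) unfolding acyclic_def by blast
qed

subsection \<open>Modules adjacent to all other vertices\<close>

locale adjacent_module =
  fixes V :: "'a set" and E :: "'a rel" and W :: "'a set"
  assumes finite_V: "finite V" and W_subset: "W \<subseteq> V"
    and out_module: "w \<in> W \<Longrightarrow> w' \<in> W \<Longrightarrow> z \<in> V - W \<Longrightarrow> (w, z) \<in> E \<Longrightarrow> (w', z) \<in> E"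
    and in_module: "w \<in> W \<Longrightarrow> w' \<in> W \<Longrightarrow> z \<in> V - W \<Longrightarrow> (z, w) \<in> E \<Longrightarrow> (z, w') \<in> E"
    and adjacent: "w \<in> W \<Longrightarrow> z \<in> V - W \<Longrightarrow> (w, z) \<in> E \<or> (z, w) \<in> E"
begin

section \<open>The classes of vertices outside \<open>W\<close>\<close>

definition S :: "'a set" where "S = {z \<in> V - W. \<forall>w\<in>W. (z, w) \<notin> E}"

definition R :: "'a set" where "R = {z \<in> V - W. \<forall>w\<in>W. (w, z) \<notin> E}"

definition B :: "'a set" where "B = V - W - S - R"

lemma arc_to_W: "w \<in> W \<Longrightarrow> z \<in> V - W \<Longrightarrow> (z, w) \<in> E \<longleftrightarrow> z \<notin> S"
  unfolding S_def using in_module by blast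

lemma arc_from_W: "w \<in> W \<Longrightarrow> z \<in> V - W \<Longrightarrow> (w, z) \<in> E \<longleftrightarrow> z \<notin> R"
  unfolding R_def using out_module by blast

text \<open>Adjacency to a vertex of \<open>W\<close> keeps \<open>S\<close> and \<open>R\<close>
  apart; for empty \<open>W\<close> they would coincide. Each case lists all four memberships so
  that simplification can evaluate the counts below.\<close>

lemma class_cases:
  assumes "v \<in> V" "W \<noteq> {}"
  obtains "v \<in> W" "v \<notin> S" "v \<notin> R" "v \<notin> B"
  | "v \<notin> W" "v \<in> S" "v \<notin> R" "v \<notin> B"
  | "v \<notin> W" "v \<notin> S" "v \<in> R" "v \<notin> B"
  | "v \<notin> W" "v \<notin> S" "v \<notin> R" "v \<in> B"
proof -
  obtain w where "w \<in> W" using assms(2) by blast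
  then have "v \<notin> W \<Longrightarrow> \<not> (v \<in> S \<and> v \<in> R)"
    using adjacent[of w v] arc_to_W[of w v] arc_from_W[of w v] assms(1) by auto
  moreover have "v \<in> W \<Longrightarrow> v \<notin> S \<and> v \<notin> R \<and> v \<notin> B" by (simp add: S_def R_def B_def)
  ultimately show ?thesis using that assms(1) unfolding B_def by blast
qed

section \<open>Counting subpaths inside \<open>W\<close> along one path\<close>

abbreviation count_in :: "'b set \<Rightarrow> 'b list \<Rightarrow> nat" where
  "count_in X xs \<equiv> length (filter (\<lambda>x. x \<in> X) xs)"

text \<open>
  The number of maximal subpaths inside \<open>W\<close> is the number of vertices in \<open>W\<close> minus the number of
  arcs inside \<open>W\<close>. Between two such subpaths a path passes through \<open>B\<close> or uses an arc from \<open>S\<close> to \<open>R\<close>.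
\<close>

lemma blocks_le:
  assumes "W \<noteq> {}" "p \<noteq> []" "set p \<subseteq> V" "set (vwalk_arcs p) \<subseteq> E"
  shows "count_in W p \<le> count_in (W \<times> W) (vwalk_arcs p) + count_in (S \<times> R) (vwalk_arcs p)
           + count_in B p + (if hd p \<in> W \<union> R then 1 else 0)"
  using assms(2-4)
proof (induction p rule: vwalk_arcs.induct)
  case (2 a)
  have "a \<in> V" using 2 by simp
  then show ?case by (rule class_cases[OF _ assms(1)]) simp_all
next
  case (3 a b xs)
  have ab: "a \<in> V" "b \<in> V" "(a, b) \<in> E" using "3.prems" by auto
  \<comment> \<open>No arc leads from \<open>W\<close> to \<open>R\<close> or from \<open>S\<close>
    to \<open>W\<close>. The term for the first vertex grants one subpath in \<open>W\<close>
    without a transition before it; after a start in \<open>S\<close> or \<open>B\<close> even the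
    first subpath needs one.\<close>
  have "\<not> (a \<in> W \<and> b \<in> R)" using ab arc_from_W[of a b] by (auto simp: R_def)
  moreover have "\<not> (a \<in> S \<and> b \<in> W)" using ab arc_to_W[of b a] by (auto simp: S_def)
  moreover have "count_in W (b # xs) \<le> count_in (W \<times> W) (vwalk_arcs (b # xs))
      + count_in (S \<times> R) (vwalk_arcs (b # xs)) + count_in B (b # xs) + (if b \<in> W \<union> R then 1 else 0)"
    using "3.IH" "3.prems" by auto
  ultimately show ?case
    by - (rule class_cases[OF ab(1) assms(1)]; rule class_cases[OF ab(2) assms(1)]; simp)
qed simp

text \<open>The inequality loses only at arcs from \<open>R\<close> or \<open>B\<close> to
  \<open>S\<close> or \<open>B\<close>, and at a last vertex in \<open>R\<close> or
  \<open>B\<close>. The last two hypotheses exclude both.\<close>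

lemma blocks_eq:
  assumes "W \<noteq> {}" "p \<noteq> []" "set p \<subseteq> V" "set (vwalk_arcs p) \<subseteq> E" "last p \<in> W \<union> S"
    and "\<And>y z. (y, z) \<in> set (vwalk_arcs p) \<Longrightarrow> y \<in> W \<or> z \<in> W \<or> y \<in> S \<or> z \<in> R"
  shows "count_in W p = count_in (W \<times> W) (vwalk_arcs p) + count_in (S \<times> R) (vwalk_arcs p)
           + count_in B p + (if hd p \<in> W \<union> R then 1 else 0)"
  using assms(2-6)
proof (induction p rule: vwalk_arcs.induct)
  case (2 a)
  have "a \<in> V" using 2 by simp
  then show ?case using 2 by - (rule class_cases[OF _ assms(1)], assumption, simp_all)
next
  case (3 a b xs)
  have ab: "a \<in> V" "b \<in> V" "(a, b) \<in> E" using "3.prems" by auto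
  have "\<not> (a \<in> W \<and> b \<in> R)" using ab arc_from_W[of a b] by (auto simp: R_def)
  moreover have "\<not> (a \<in> S \<and> b \<in> W)" using ab arc_to_W[of b a] by (auto simp: S_def)
  moreover have "a \<in> W \<or> b \<in> W \<or> a \<in> S \<or> b \<in> R" using "3.prems"(5)[of a b] by simp
  moreover have "count_in W (b # xs) = count_in (W \<times> W) (vwalk_arcs (b # xs))
      + count_in (S \<times> R) (vwalk_arcs (b # xs)) + count_in B (b # xs) + (if hd (b # xs) \<in> W \<union> R then 1 else 0)"
  proof (rule "3.IH")
    show "y \<in> W \<or> z \<in> W \<or> y \<in> S \<or> z \<in> R" if "(y, z) \<in> set (vwalk_arcs (b # xs))" for y z
      using "3.prems"(5)[of y z] that by simp
  qed (use "3.prems" in auto)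
  ultimately show ?case
    by - (rule class_cases[OF ab(1) assms(1)]; rule class_cases[OF ab(2) assms(1)]; simp)
qed simp

text \<open>Each arc leaves \<open>S\<close> or enters \<open>R\<close>, so such a path runs through
  \<open>S\<close>, then through at most one vertex of \<open>B\<close>, then through
  \<open>R\<close>. It has exactly one transition unless it lies entirely in \<open>S\<close> or
  entirely in \<open>R\<close>.\<close>

lemma outer_path_count:
  assumes "W \<noteq> {}" "p \<noteq> []" "set p \<subseteq> V - W"
    and "\<And>y z. (y, z) \<in> set (vwalk_arcs p) \<Longrightarrow> y \<in> S \<or> z \<in> R"
  shows "(hd p \<in> R \<longrightarrow> last p \<in> R) \<and> count_in (S \<times> R) (vwalk_arcs p) + count_in B p
           = (if hd p \<notin> R \<and> last p \<notin> S then 1 else 0)"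
  using assms(2-4)
proof (induction p rule: vwalk_arcs.induct)
  case (2 a)
  have "a \<in> V" using 2 by simp
  then show ?case using 2 by - (rule class_cases[OF _ assms(1)], assumption, simp_all)
next
  case (3 a b xs)
  have ab: "a \<in> V" "b \<in> V" and nW: "a \<notin> W" "b \<notin> W" using "3.prems" by auto
  have l: "last (b # xs) \<in> V" using "3.prems"(2) last_in_set[of "b # xs"] by auto
  have "a \<in> S \<or> b \<in> R" using "3.prems"(3)[of a b] by simp
  moreover have "(hd (b # xs) \<in> R \<longrightarrow> last (b # xs) \<in> R) \<and>
      count_in (S \<times> R) (vwalk_arcs (b # xs)) + count_in B (b # xs)
        = (if hd (b # xs) \<notin> R \<and> last (b # xs) \<notin> S then 1 else 0)"
  proof (rule "3.IH")
    show "y \<in> S \<or> z \<in> R" if "(y, z) \<in> set (vwalk_arcs (b # xs))" for y z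
      using "3.prems"(3)[of y z] that by simp
  qed (use "3.prems" in auto)
  moreover have "last (b # xs) \<in> R \<Longrightarrow> last (b # xs) \<notin> S"
    by (rule class_cases[OF l assms(1)]) auto
  ultimately show ?case using nW
    by - (rule class_cases[OF ab(1) assms(1)]; rule class_cases[OF ab(2) assms(1)]; simp split: if_splits)
qed simp

section \<open>Reassembling paths from pieces inside and outside \<open>W\<close>\<close>

text \<open>The path is built as \<open>u\<close>, \<open>f\<close>, \<open>u\<close>,
  \<open>f\<close> and so on, with \<open>c\<close> at the end. A piece outside \<open>W\<close>
  fits between any two pieces inside, since it neither starts in \<open>R\<close> nor ends in
  \<open>S\<close>. Equality of multisets leaves distinctness to the final assembly.\<close>

lemma interleave:
  assumes "length us = length fs"
    and "\<forall>u\<in>set us. u \<noteq> [] \<and> set u \<subseteq> W \<and> set (vwalk_arcs u) \<subseteq> E"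
    and "\<forall>f\<in>set fs. f \<noteq> [] \<and> set f \<subseteq> V - W \<and> set (vwalk_arcs f) \<subseteq> E \<and> hd f \<notin> R \<and> last f \<notin> S"
    and "c \<noteq> []" "set c \<subseteq> W" "set (vwalk_arcs c) \<subseteq> E"
  shows "\<exists>q. q \<noteq> [] \<and> hd q \<in> W \<and> last q \<in> W \<and> set (vwalk_arcs q) \<subseteq> E \<and>
           mset q = mset (concat us) + mset (concat fs) + mset c"
  using assms(1-3)
proof (induction us fs rule: list_induct2)
  case Nil
  then show ?case using assms(4-6) by (intro exI[of _ c]) auto
next
  case (Cons u us f fs)
  then obtain q where q: "q \<noteq> []" "hd q \<in> W" "last q \<in> W" "set (vwalk_arcs q) \<subseteq> E"
    "mset q = mset (concat us) + mset (concat fs) + mset c" by auto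
  have u: "u \<noteq> []" "set u \<subseteq> W" "set (vwalk_arcs u) \<subseteq> E"
    and f: "f \<noteq> []" "set f \<subseteq> V - W" "set (vwalk_arcs f) \<subseteq> E" "hd f \<notin> R" "last f \<notin> S"
    using Cons.prems by auto
  have hl: "hd u \<in> W" "last u \<in> W" "hd f \<in> V - W" "last f \<in> V - W"
    by (rule subsetD[OF u(2) hd_in_set[OF u(1)]] subsetD[OF u(2) last_in_set[OF u(1)]]
          subsetD[OF f(2) hd_in_set[OF f(1)]] subsetD[OF f(2) last_in_set[OF f(1)]])+
  then have "(last u, hd f) \<in> E" "(last f, hd q) \<in> E"
    using f(4,5) q(2) arc_from_W[of "last u" "hd f"] arc_to_W[of "hd q" "last f"] by simp_all
  then show ?case using u f q hl
    by (intro exI[of _ "u @ f @ q"]) (auto simp: vwalk_arcs_append_subset)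
qed

text \<open>Path number \<open>j\<close> becomes \<open>r @ c @ s\<close> with the entries at
  position \<open>j\<close>. An empty \<open>r\<close> or \<open>s\<close> means that nothing is
  attached at that end, which allows the lists to be padded to equal length.\<close>

lemma attach_ends:
  assumes "length rs = length cs" "length cs = length ss"
    and "\<forall>r\<in>set rs. r = [] \<or> set r \<subseteq> V - W \<and> set (vwalk_arcs r) \<subseteq> E \<and> last r \<notin> S"
    and "\<forall>c\<in>set cs. c \<noteq> [] \<and> hd c \<in> W \<and> last c \<in> W \<and> set (vwalk_arcs c) \<subseteq> E"
    and "\<forall>s\<in>set ss. s = [] \<or> set s \<subseteq> V - W \<and> set (vwalk_arcs s) \<subseteq> E \<and> hd s \<notin> R"
  shows "\<exists>qs. length qs = length cs \<and> [] \<notin> set qs \<and> path_arcs qs \<subseteq> E \<and>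
           mset (concat qs) = mset (concat rs) + mset (concat cs) + mset (concat ss)"
  using assms
proof (induction rs cs ss rule: list_induct3)
  case Nil
  then show ?case by (intro exI[of _ "[]"]) (simp add: path_arcs_def)
next
  case (Cons r rs c cs s ss)
  then obtain qs where qs: "length qs = length cs" "[] \<notin> set qs" "path_arcs qs \<subseteq> E"
    "mset (concat qs) = mset (concat rs) + mset (concat cs) + mset (concat ss)" by auto
  have c: "c \<noteq> []" "hd c \<in> W" "last c \<in> W" "set (vwalk_arcs c) \<subseteq> E" using Cons.prems by auto
  have "r = [] \<or> set (vwalk_arcs r) \<subseteq> E \<and> (last r, hd c) \<in> E"
  proof (cases "r = []")
    case False
    then have "set r \<subseteq> V - W" "last r \<notin> S" using Cons.prems(1) by simp_all
    moreover from this have "last r \<in> V - W" using last_in_set[OF False] by (blast intro: subsetD)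
    ultimately show ?thesis using Cons.prems(1) c(2) arc_to_W[of "hd c" "last r"] by auto
  qed simp
  moreover have "s = [] \<or> set (vwalk_arcs s) \<subseteq> E \<and> (last c, hd s) \<in> E"
  proof (cases "s = []")
    case False
    then have "set s \<subseteq> V - W" "hd s \<notin> R" using Cons.prems(3) by simp_all
    moreover from this have "hd s \<in> V - W" using hd_in_set[OF False] by (blast intro: subsetD)
    ultimately show ?thesis using Cons.prems(3) c(3) arc_from_W[of "last c" "hd s"] by auto
  qed simp
  ultimately have "set (vwalk_arcs (r @ c @ s)) \<subseteq> E"
    using c by (auto simp: vwalk_arcs_append_subset)
  then show ?case using qs c
    by (intro exI[of _ "(r @ c @ s) # qs"]) (auto simp: path_arcs_def)
qed

text \<open>
  A path avoiding \<open>W\<close> that neither starts in \<open>R\<close> nor ends in \<open>S\<close> can be placed between two subpaths of \<open>W\<close>;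
  one path is built by alternating these, and the paths starting in \<open>R\<close> or ending in \<open>S\<close> are
  put at the beginning or at the end of the \<open>k\<close> paths.
\<close>

lemma rebuild:
  assumes ns: "path_system (V - W) E ns" and ws: "path_system W E ws"
    and typed: "\<And>y z. (y, z) \<in> path_arcs ns \<Longrightarrow> y \<in> S \<or> z \<in> R"
    and last_le: "length (filter (\<lambda>p. last p \<in> S) ns) \<le> k"
    and hd_le: "length (filter (\<lambda>p. hd p \<in> R) ns) \<le> k"
    and len: "length ws = card (path_arcs ns \<inter> S \<times> R) + card (set (concat ns) \<inter> B) + k"
    and k: "k \<ge> 1"
  obtains qs where "path_system V E qs" "length qs = k"
    "set (concat qs) = set (concat ws) \<union> set (concat ns)"
proof -
  have "ws \<noteq> []" "[] \<notin> set ws" "set (concat ws) \<subseteq> W"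
    using len k ws by (auto simp: path_system_def)
  then have "W \<noteq> {}" by (cases ws) auto
  have p: "p \<noteq> [] \<and> set p \<subseteq> V - W \<and> set (vwalk_arcs p) \<subseteq> E \<and> (hd p \<in> R \<longrightarrow> last p \<in> R) \<and>
      count_in (S \<times> R) (vwalk_arcs p) + count_in B p = (if hd p \<notin> R \<and> last p \<notin> S then 1 else 0)"
    if "p \<in> set ns" for p
  proof -
    have *: "p \<noteq> []" "set p \<subseteq> V - W" "set (vwalk_arcs p) \<subseteq> E" "set (vwalk_arcs p) \<subseteq> path_arcs ns"
      using ns that by (auto simp: path_system_def path_arcs_def)
    show ?thesis using * outer_path_count[OF \<open>W \<noteq> {}\<close> *(1,2)] typed by blast
  qed
  have RS: "last p \<in> R \<Longrightarrow> last p \<notin> S" if "p \<in> set ns" for p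
  proof -
    have "last p \<in> V" using p[OF that] last_in_set[of p] by blast
    then show "last p \<in> R \<Longrightarrow> last p \<notin> S" by (rule class_cases[OF _ \<open>W \<noteq> {}\<close>]) auto
  qed
  define fs where "fs = filter (\<lambda>p. hd p \<notin> R \<and> last p \<notin> S) ns"
  define ss where "ss = filter (\<lambda>p. last p \<in> S) ns"
  define rs where "rs = filter (\<lambda>p. hd p \<in> R) ns"
  have dist: "distinct (concat ns)" using ns by (simp add: path_system_def)
  \<comment> \<open>Each path in \<open>fs\<close> contains exactly one transition and all others
    contain none, so \<open>length fs\<close> counts the transitions.\<close>
  have "card (path_arcs ns \<inter> S \<times> R) + card (set (concat ns) \<inter> B)
      = (\<Sum>p\<leftarrow>ns. count_in (S \<times> R) (vwalk_arcs p) + count_in B p)"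
    unfolding card_path_arcs_Int[OF dist] card_concat_Int[OF dist] by (rule sum_list_addf[symmetric])
  also have "\<dots> = (\<Sum>p\<leftarrow>ns. if hd p \<notin> R \<and> last p \<notin> S then 1 else 0)"
    using p by (intro arg_cong[of _ _ sum_list] map_cong) auto
  also have "\<dots> = length fs" unfolding fs_def by (induction ns) auto
  finally have lfs: "length ws = length fs + k" using len by simp
  have "mset (concat ns) = mset (concat rs) + mset (concat fs) + mset (concat ss)"
    if "\<forall>p\<in>set ns. \<not> (hd p \<in> R \<and> last p \<in> S)"
    unfolding rs_def fs_def ss_def using that by (induction ns) auto
  then have msn: "mset (concat ns) = mset (concat rs) + mset (concat fs) + mset (concat ss)"
    using p RS by blast
  \<comment> \<open>The pieces \<open>us\<close> alternate with \<open>fs\<close>. Of the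
    \<open>k\<close> pieces that remain, \<open>c0\<close> closes the alternating path and
    \<open>ts\<close> supplies the cores of the other \<open>k - 1\<close> paths.\<close>
  define us where "us = take (length fs) ws"
  obtain c0 ts where ts: "drop (length fs) ws = c0 # ts"
    using lfs k by (cases "drop (length fs) ws") auto
  have wsplit: "ws = us @ c0 # ts" using ts by (metis append_take_drop_id us_def)
  have wp: "w \<noteq> [] \<and> set w \<subseteq> W \<and> set (vwalk_arcs w) \<subseteq> E" if "w \<in> set ws" for w
    using ws that by (auto simp: path_system_def path_arcs_def)
  have lus: "length us = length fs" using lfs by (simp add: us_def)
  have us: "\<forall>u\<in>set us. u \<noteq> [] \<and> set u \<subseteq> W \<and> set (vwalk_arcs u) \<subseteq> E"
    using wp wsplit by simp
  have fs: "\<forall>f\<in>set fs. f \<noteq> [] \<and> set f \<subseteq> V - W \<and> set (vwalk_arcs f) \<subseteq> E \<and> hd f \<notin> R \<and> last f \<notin> S"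
    using p by (simp add: fs_def)
  have c0: "c0 \<noteq> []" "set c0 \<subseteq> W" "set (vwalk_arcs c0) \<subseteq> E" using wp[of c0] wsplit by auto
  obtain q where q: "q \<noteq> []" "hd q \<in> W" "last q \<in> W" "set (vwalk_arcs q) \<subseteq> E"
    "mset q = mset (concat us) + mset (concat fs) + mset c0"
    using interleave[OF lus us fs c0] by blast
  define rs' where "rs' = rs @ replicate (k - length rs) []"
  define ss' where "ss' = ss @ replicate (k - length ss) []"
  have lts: "length (q # ts) = k" using lfs wsplit lus by simp
  have cs: "\<forall>c\<in>set (q # ts). c \<noteq> [] \<and> hd c \<in> W \<and> last c \<in> W \<and> set (vwalk_arcs c) \<subseteq> E"
  proof
    fix c assume "c \<in> set (q # ts)"
    then consider "c = q" | "c \<in> set ws" using wsplit by auto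
    then show "c \<noteq> [] \<and> hd c \<in> W \<and> last c \<in> W \<and> set (vwalk_arcs c) \<subseteq> E"
      using q wp[of c] hd_in_set[of c] last_in_set[of c] by cases auto
  qed
  have lens: "length rs' = length (q # ts)" "length (q # ts) = length ss'"
    using hd_le last_le lts by (auto simp: rs'_def ss'_def rs_def ss_def)
  have rs': "\<forall>r\<in>set rs'. r = [] \<or> set r \<subseteq> V - W \<and> set (vwalk_arcs r) \<subseteq> E \<and> last r \<notin> S"
    using p RS by (auto simp: rs'_def rs_def)
  have ss': "\<forall>s\<in>set ss'. s = [] \<or> set s \<subseteq> V - W \<and> set (vwalk_arcs s) \<subseteq> E \<and> hd s \<notin> R"
    using p RS by (auto simp: ss'_def ss_def)
  obtain qs where qs: "length qs = length (q # ts)" "[] \<notin> set qs" "path_arcs qs \<subseteq> E"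
    "mset (concat qs) = mset (concat rs') + mset (concat (q # ts)) + mset (concat ss')"
    using attach_ends[OF lens rs' cs ss'] by blast
  have "concat (replicate n []) = ([] :: 'a list)" for n by (induction n) auto
  then have "mset (concat rs') = mset (concat rs)" "mset (concat ss') = mset (concat ss)"
    by (auto simp: rs'_def ss'_def)
  then have ms: "mset (concat qs) = mset (concat (ws @ ns))"
    using qs(4) q(5) msn wsplit by simp
  have "set (concat ws) \<inter> set (concat ns) = {}" using ws ns unfolding path_system_def by blast
  then have "distinct (concat (ws @ ns))" using ws ns by (simp add: path_system_def)
  then have "distinct (concat qs)" using mset_eq_imp_distinct_iff[OF ms] by simp
  moreover have sq: "set (concat qs) = set (concat ws) \<union> set (concat ns)"
    using mset_eq_setD[OF ms] by simp
  moreover have "set (concat qs) \<subseteq> V" unfolding sq using ws ns W_subset unfolding path_system_def by blast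
  ultimately show ?thesis using qs lts by (intro that[of qs]) (auto simp: path_system_def)
qed

end

subsection \<open>Maximum path systems leaving a vertex of the module uncovered\<close>

locale unsaturated_maximum_system = adjacent_module +
  fixes ps :: "'a list list" and k :: nat and x :: 'a
  assumes ps: "path_system V E ps" and length_ps: "length ps = k" and k_pos: "k \<ge> 1"
    and maximum: "path_system V E qs \<Longrightarrow> length qs = k \<Longrightarrow>
      card (set (concat qs)) \<le> card (set (concat ps))"
    and x_W: "x \<in> W" and x_uncovered: "x \<notin> set (concat ps)"
begin

abbreviation U :: "'a set" where "U \<equiv> set (concat ps)"

section \<open>The shape forced on a maximum system by an uncovered vertex\<close>

lemma W_nonempty: "W \<noteq> {}" and x_V: "x \<in> V"
  using x_W W_subset by auto

lemma distinct_ps: "distinct (concat ps)" and U_subset: "U \<subseteq> V" and arcs_subset: "path_arcs ps \<subseteq> E"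
  using ps by (auto simp: path_system_def)

lemma in_ps:
  assumes "p \<in> set ps"
  shows "p \<noteq> []" "set p \<subseteq> U" "set p \<subseteq> V" "set (vwalk_arcs p) \<subseteq> E"
  using ps assms by (auto simp: path_system_def path_arcs_def)

text \<open>The insertion would give \<open>k\<close> paths covering more vertices. As
  \<open>l\<close> or \<open>r\<close> may be empty, extensions at either end of a path are
  included.\<close>

lemma no_insertion:
  assumes "l @ r \<in> set ps" "q \<noteq> []" "distinct q" "set q \<subseteq> V - U"
  shows "\<not> set (vwalk_arcs (l @ q @ r)) \<subseteq> E"
proof
  assume arcs: "set (vwalk_arcs (l @ q @ r)) \<subseteq> E"
  obtain as bs where split: "ps = as @ (l @ r) # bs" using assms(1) by (meson split_list)
  define qs where "qs = as @ (l @ q @ r) # bs"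
  have ms: "mset (concat qs) = mset (concat ps @ q)" by (simp add: qs_def split)
  have "distinct (concat ps @ q)" using distinct_ps assms(3,4) by auto
  then have "distinct (concat qs)" using mset_eq_imp_distinct_iff[OF ms] by simp
  moreover have sq: "set (concat qs) = U \<union> set q" using mset_eq_setD[OF ms] by simp
  moreover have "[] \<notin> set qs" using ps assms(2) by (auto simp: qs_def split path_system_def)
  moreover have "path_arcs qs \<subseteq> E"
    using arcs arcs_subset by (auto simp: qs_def split path_arcs_def)
  ultimately have "path_system V E qs"
    using U_subset assms(4) unfolding path_system_def by blast
  then have "card (U \<union> set q) \<le> card U"
    using maximum[of qs] length_ps sq by (simp add: qs_def split)
  moreover have "card (U \<union> set q) = card U + card (set q)"
    using assms(4) by (intro card_Un_disjoint) auto
  ultimately show False using assms(2) by simp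
qed

text \<open>Otherwise \<open>x\<close> could be appended. The next two facts try \<open>x\<close> in
  the same way before a path and on an arc.\<close>

lemma last_class:
  assumes "p \<in> set ps"
  shows "last p \<in> W \<union> S"
proof (rule ccontr)
  assume "last p \<notin> W \<union> S"
  moreover have "last p \<in> V" using in_ps[OF assms] last_in_set by blast
  ultimately have "(last p, x) \<in> E" using arc_to_W[OF x_W] by blast
  then have "set (vwalk_arcs (p @ [x] @ [])) \<subseteq> E"
    using in_ps[OF assms] by (simp add: vwalk_arcs_append_subset)
  then show False using no_insertion[of p "[]" "[x]"] assms x_V x_uncovered by simp
qed

lemma hd_class:
  assumes "p \<in> set ps"
  shows "hd p \<in> W \<union> R"
proof (rule ccontr)
  assume "hd p \<notin> W \<union> R"
  moreover have "hd p \<in> V" using in_ps[OF assms] hd_in_set by blast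
  ultimately have "(x, hd p) \<in> E" using arc_from_W[OF x_W] by blast
  then have "set (vwalk_arcs ([] @ [x] @ p)) \<subseteq> E"
    using in_ps[OF assms] by (simp add: vwalk_arcs_append_subset)
  then show False using no_insertion[of "[]" p "[x]"] assms x_V x_uncovered by simp
qed

lemma arc_class:
  assumes "(y, z) \<in> path_arcs ps"
  shows "y \<in> W \<or> z \<in> W \<or> y \<in> S \<or> z \<in> R"
proof (rule ccontr)
  assume not: "\<not> ?thesis"
  obtain p where p: "p \<in> set ps" "(y, z) \<in> set (vwalk_arcs p)"
    using assms by (auto simp: path_arcs_def)
  obtain l r where lr: "p = l @ y # z # r" using p(2) by (rule in_vwalk_arcs_split)
  have "y \<in> V" "z \<in> V" using in_ps[OF p(1)] lr by auto
  then have "(y, x) \<in> E" "(x, z) \<in> E" using arc_to_W[OF x_W, of y] arc_from_W[OF x_W, of z] not by auto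
  moreover have "set (vwalk_arcs ((l @ [y]) @ (z # r))) \<subseteq> E" using in_ps(4)[OF p(1)] lr by simp
  then have "set (vwalk_arcs (l @ [y])) \<subseteq> E" "set (vwalk_arcs (z # r)) \<subseteq> E"
    unfolding vwalk_arcs_append_subset by auto
  ultimately have "set (vwalk_arcs ((l @ [y]) @ [x] @ (z # r))) \<subseteq> E"
    unfolding vwalk_arcs_append_subset[of "l @ [y]"] vwalk_arcs_append_subset[of "[x]"] by simp
  then show False using no_insertion[of "l @ [y]" "z # r" "[x]"] p(1) lr x_V x_uncovered by simp
qed

text \<open>The exact count \<open>blocks_eq\<close> is summed over the paths. Each of them starts
  in \<open>W\<close> or \<open>R\<close> and so contributes one to the summand
  \<open>k\<close>.\<close>

lemma card_U_W:
  "card (U \<inter> W) = card (path_arcs ps \<inter> W \<times> W) + card (path_arcs ps \<inter> S \<times> R) + card (U \<inter> B) + k"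
proof -
  have "count_in W p = count_in (W \<times> W) (vwalk_arcs p) + count_in (S \<times> R) (vwalk_arcs p)
           + count_in B p + 1" if p: "p \<in> set ps" for p
  proof -
    have "y \<in> W \<or> z \<in> W \<or> y \<in> S \<or> z \<in> R" if "(y, z) \<in> set (vwalk_arcs p)" for y z
      using that p by (intro arc_class) (auto simp: path_arcs_def)
    then show ?thesis
      using blocks_eq[OF W_nonempty in_ps(1,3,4)[OF p] last_class[OF p]] hd_class[OF p] by simp
  qed
  then have "(\<Sum>p\<leftarrow>ps. count_in W p) = (\<Sum>p\<leftarrow>ps. count_in (W \<times> W) (vwalk_arcs p)
      + count_in (S \<times> R) (vwalk_arcs p) + count_in B p + 1)"
    by (intro arg_cong[of _ _ sum_list] map_cong) auto
  then show ?thesis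
    unfolding card_concat_Int[OF distinct_ps] card_path_arcs_Int[OF distinct_ps]
      sum_list_addf sum_list_triv length_ps by simp
qed

text \<open>An uncovered \<open>b\<close> could be inserted after a covered vertex \<open>a\<close>
  of \<open>W\<close>: alone if \<open>a\<close> ends its path or is followed by a vertex of
  \<open>W\<close>, and followed by \<open>x\<close> otherwise, since \<open>x\<close> has the same
  neighbours outside \<open>W\<close> as \<open>a\<close>.\<close>

lemma B_subset: "B \<subseteq> U"
proof
  fix b assume b: "b \<in> B"
  then have bV: "b \<in> V - W" "b \<notin> S" "b \<notin> R" by (auto simp: B_def)
  show "b \<in> U"
  proof (rule ccontr)
    assume nb: "b \<notin> U"
    have "card (U \<inter> W) > 0" using card_U_W k_pos by linarith
    then obtain a where "a \<in> U" "a \<in> W" by (metis Int_iff card.empty ex_in_conv less_irrefl)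
    then obtain p where p: "p \<in> set ps" "a \<in> set p" by auto
    obtain l r where lr: "p = (l @ [a]) @ r" using split_list[OF p(2)] by auto
    have arcs: "set (vwalk_arcs (l @ [a])) \<subseteq> E" "set (vwalk_arcs r) \<subseteq> E" and ar: "r = [] \<or> (a, hd r) \<in> E"
      using in_ps(4)[OF p(1)] unfolding lr vwalk_arcs_append_subset by auto
    have ab: "(a, b) \<in> E" and bx: "(b, x) \<in> E"
      using bV arc_from_W[OF \<open>a \<in> W\<close>] arc_to_W[OF x_W] by auto
    have noins: "\<not> set (vwalk_arcs ((l @ [a]) @ q @ r)) \<subseteq> E" if "q = [b] \<or> q = [b, x]" for q
      using that p(1) lr nb x_uncovered x_V bV x_W
      by (intro no_insertion) auto
    show False
    proof (cases "r = [] \<or> hd r \<in> W")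
      case True
      then have "r = [] \<or> (b, hd r) \<in> E" using bV arc_to_W by blast
      then have "set (vwalk_arcs ((l @ [a]) @ [b] @ r)) \<subseteq> E"
        using arcs ab unfolding vwalk_arcs_append_subset[of "l @ [a]"] vwalk_arcs_append_subset[of "[b]"]
        by auto
      then show False using noins by blast
    next
      case False
      have "set r \<subseteq> V" using in_ps(3)[OF p(1)] lr by auto
      then have "hd r \<in> V - W" using False hd_in_set[of r] by auto
      then have "(x, hd r) \<in> E" using ar False out_module[OF \<open>a \<in> W\<close> x_W] by blast
      then have "set (vwalk_arcs ((l @ [a]) @ [b, x] @ r)) \<subseteq> E"
        using arcs ab bx False
        unfolding vwalk_arcs_append_subset[of "l @ [a]"] vwalk_arcs_append_subset[of "[b, x]"]
        by auto
      then show False using noins by blast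
    qed
  qed
qed

section \<open>Replacing the whole system and comparing with another one\<close>

text \<open>The forests \<open>A\<close> on \<open>N\<close> and \<open>D\<close> on
  \<open>X\<close> are reassembled into \<open>k\<close> paths. By \<open>card_X\<close>, the pieces
  of \<open>D\<close> outnumber the transitions by exactly \<open>k\<close>; \<open>ends\<close> and
  \<open>starts\<close> leave at most \<open>k\<close> pieces to attach at either end. Since
  \<open>N\<close> contains \<open>U - W\<close>, maximality bounds \<open>X\<close>.\<close>

lemma card_replacement_le:
  assumes N: "A \<subseteq> E" "A \<subseteq> N \<times> N" "single_valued A" "single_valued (A\<inverse>)" "acyclic A"
    and N_sub: "U - W \<subseteq> N" "N \<subseteq> V - W"
    and typed: "\<And>y z. (y, z) \<in> A \<Longrightarrow> y \<in> S \<or> z \<in> R"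
    and ends: "N \<inter> S - Domain A \<subseteq> U - Domain (path_arcs ps)"
    and starts: "N \<inter> R - Range A \<subseteq> U - Range (path_arcs ps)"
    and X: "X \<subseteq> W" "D \<subseteq> E" "D \<subseteq> X \<times> X" "single_valued D" "single_valued (D\<inverse>)" "acyclic D"
    and card_X: "card X = card D + card (A \<inter> S \<times> R) + card (N \<inter> B) + k"
  shows "card X \<le> card (U \<inter> W)"
proof -
  have fin: "finite N" "finite X" "finite A" "finite D"
    using N_sub(2) X(1,3) N(2) W_subset finite_V
    by (meson finite_Diff finite_SigmaI rev_finite_subset)+
  obtain ns where ns: "distinct (concat ns)" "[] \<notin> set ns" "set (concat ns) = N" "path_arcs ns = A"
    using linear_forest_paths[OF fin(3,1) N(2-5)] by blast
  obtain ws where ws: "distinct (concat ws)" "[] \<notin> set ws" "set (concat ws) = X" "path_arcs ws = D"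
    using linear_forest_paths[OF fin(4,2) X(3-6)] by blast
  have sys: "path_system (V - W) E ns" "path_system W E ws"
    unfolding path_system_def using ns ws N(1) N_sub(2) X(1,2) by auto
  have ne: "p \<noteq> []" if "p \<in> set ns" for p using that ns(2) by auto
  have in_N: "last p \<in> N" "hd p \<in> N" if "p \<in> set ns" for p
    using that ns(3) last_in_set[OF ne[OF that]] hd_in_set[OF ne[OF that]] by auto
  have dns: "distinct (filter P ns)" for P
    using ns(1,2) by (auto simp: distinct_concat_iff removeAll_id)
  have inj: "inj_on last (set ns)" "inj_on hd (set ns)"
    using distinct_concat_in_same[OF ns(1)] last_in_set[OF ne] hd_in_set[OF ne]
    by (auto simp: inj_on_def) metis+
  \<comment> \<open>Different pieces have different last vertices, and those in \<open>S\<close>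
    also end paths of \<open>ps\<close>, of which there are \<open>k\<close>. First vertices in
    \<open>R\<close> are treated likewise below.\<close>
  have "length (filter (\<lambda>p. last p \<in> S) ns) = card (last ` {p \<in> set ns. last p \<in> S})"
  proof (subst card_image)
    show "inj_on last {p \<in> set ns. last p \<in> S}" using inj(1) by (rule inj_on_subset) auto
    show "length (filter (\<lambda>p. last p \<in> S) ns) = card {p \<in> set ns. last p \<in> S}"
      using distinct_card[OF dns, of "\<lambda>p. last p \<in> S"] by simp
  qed
  also have "\<dots> \<le> card (last ` set ps)"
  proof (rule card_mono)
    show "last ` {p \<in> set ns. last p \<in> S} \<subseteq> last ` set ps"
    proof (rule image_subsetI)
      fix p assume "p \<in> {p \<in> set ns. last p \<in> S}"
      then have "last p \<in> N \<inter> S - Domain A"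
        using in_N(1)[of p] last_not_in_Domain_path_arcs[OF ns(1), of p] ne ns(4) by auto
      then have "last p \<in> U - Domain (path_arcs ps)" using ends by (rule subsetD[rotated])
      then show "last p \<in> last ` set ps" by (intro not_in_Domain_path_arcs) auto
    qed
  qed simp
  also have "\<dots> \<le> k" using card_image_le[of "set ps" last] card_length[of ps] length_ps by simp
  finally have le1: "length (filter (\<lambda>p. last p \<in> S) ns) \<le> k" .
  have "length (filter (\<lambda>p. hd p \<in> R) ns) = card (hd ` {p \<in> set ns. hd p \<in> R})"
  proof (subst card_image)
    show "inj_on hd {p \<in> set ns. hd p \<in> R}" using inj(2) by (rule inj_on_subset) auto
    show "length (filter (\<lambda>p. hd p \<in> R) ns) = card {p \<in> set ns. hd p \<in> R}"
      using distinct_card[OF dns, of "\<lambda>p. hd p \<in> R"] by simp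
  qed
  also have "\<dots> \<le> card (hd ` set ps)"
  proof (rule card_mono)
    show "hd ` {p \<in> set ns. hd p \<in> R} \<subseteq> hd ` set ps"
    proof (rule image_subsetI)
      fix p assume "p \<in> {p \<in> set ns. hd p \<in> R}"
      then have "hd p \<in> N \<inter> R - Range A"
        using in_N(2)[of p] hd_not_in_Range_path_arcs[OF ns(1), of p] ne ns(4) by auto
      then have "hd p \<in> U - Range (path_arcs ps)" using starts by (rule subsetD[rotated])
      then show "hd p \<in> hd ` set ps" by (intro not_in_Range_path_arcs) auto
    qed
  qed simp
  also have "\<dots> \<le> k" using card_image_le[of "set ps" hd] card_length[of ps] length_ps by simp
  finally have le2: "length (filter (\<lambda>p. hd p \<in> R) ns) \<le> k" .
  have len: "length ws = card (path_arcs ns \<inter> S \<times> R) + card (set (concat ns) \<inter> B) + k"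
    using length_eq_card_diff[OF ws(1,2)] card_X unfolding ns(3,4) ws(3,4) by simp
  obtain qs where qs: "path_system V E qs" "length qs = k" "set (concat qs) = X \<union> N"
  proof (rule rebuild[OF sys _ le1 le2 len k_pos])
    show "y \<in> S \<or> z \<in> R" if "(y, z) \<in> path_arcs ns" for y z using typed that ns(4) by simp
  qed (use that ns(3) ws(3) in simp)
  have "card X + card N = card (X \<union> N)"
    using fin X(1) N_sub(2) by (intro card_Un_disjoint[symmetric]) auto
  also have "\<dots> \<le> card U" using maximum[OF qs(1,2)] qs(3) by simp
  also have "\<dots> = card (U \<inter> W) + card (U - W)"
    by (subst card_Un_disjoint[symmetric]) (auto simp: Int_Diff_Un)
  also have "card (U - W) \<le> card N" using N_sub(1) fin(1) by (rule card_mono[rotated])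
  finally show ?thesis by simp
qed

lemma covers_max:
  assumes ps': "path_system V E ps'" "length ps' = k"
  shows "card (set (concat ps') \<inter> W) \<le> card (U \<inter> W)"
proof (rule ccontr)
  define A where "A = path_arcs ps"
  define A' where "A' = path_arcs ps'"
  define X' where "X' = set (concat ps') \<inter> W"
  define N where "N = A \<inter> (- W) \<times> (- W)"
  assume "\<not> ?thesis"
  then have gt: "card (U \<inter> W) < card X'" by (simp add: X'_def)
  note forest = path_arcs_linear_forest[OF distinct_ps, folded A_def]
  have dps': "distinct (concat ps')" and A'E: "A' \<subseteq> E"
    using ps' by (auto simp: path_system_def A'_def)
  note forest' = path_arcs_linear_forest[OF dps', folded A'_def]
  have finA: "finite A" "finite A'" by (simp_all add: A_def A'_def finite_path_arcs)
  have AE: "A \<subseteq> E" using arcs_subset by (simp add: A_def)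
  have AU: "y \<in> U" "z \<in> U" if "(y, z) \<in> A" for y z using that forest(4) by auto
  have SR: "S \<subseteq> V - W" "R \<subseteq> V - W" "S \<inter> R = {}"
    using adjacent[OF x_W] x_W by (auto simp: S_def R_def)
  have S_W: "z \<notin> W" if "(y, z) \<in> A" "y \<in> S" for y z
    using that AE SR(1) arc_to_W[of z y] by blast
  have W_R: "y \<notin> W" if "(y, z) \<in> A" "z \<in> R" for y z
    using that AE SR(2) arc_from_W[of y z] by blast
  have A_class: "y \<in> W \<or> z \<in> W \<or> y \<in> S \<or> z \<in> R" if "(y, z) \<in> A" for y z
    using that arc_class by (simp add: A_def)
  have NSR: "N \<inter> S \<times> R = A \<inter> S \<times> R" using SR by (auto simp: N_def)
  have UB: "(U - W) \<inter> B = U \<inter> B" by (auto simp: B_def)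
  have cW: "card (U \<inter> W) = card (A \<inter> W \<times> W) + card (A \<inter> S \<times> R) + card (U \<inter> B) + k"
    using card_U_W by (simp add: A_def)
  show False
  \<comment> \<open>The cases ask whether \<open>ps'\<close> has at most as many subpaths in
    \<open>W\<close> as \<open>ps\<close>; the latter number is given by \<open>cW\<close>.\<close>
  proof (cases "card X' \<le> card (A' \<inter> W \<times> W) + card (A \<inter> S \<times> R) + card (U \<inter> B) + k")
    case True
    txt \<open>Cut the \<open>W\<close>-parts of the competing paths into as many pieces as the maximum system has.\<close>
    define d where "d = card X' - (card (A \<inter> S \<times> R) + card (U \<inter> B) + k)"
    have "d \<le> card (A' \<inter> W \<times> W)" using True by (simp add: d_def)
    then obtain D where D: "D \<subseteq> A' \<inter> W \<times> W" "card D = d"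
      using obtain_subset_with_card_n by metis
    have "card X' \<le> card (U \<inter> W)"
    proof (rule card_replacement_le[of N "U - W" X' D])
      show "N \<subseteq> E" "N \<subseteq> (U - W) \<times> (U - W)" using AE AU by (auto simp: N_def)
      have "N \<subseteq> A" by (auto simp: N_def)
      then show "single_valued N" "single_valued (N\<inverse>)" "acyclic N"
        by (rule linear_forest_subset[OF forest(1-3), of N])+
      show "U - W \<subseteq> U - W" "U - W \<subseteq> V - W" using U_subset by auto
      show "y \<in> S \<or> z \<in> R" if "(y, z) \<in> N" for y z
        using that A_class by (auto simp: N_def)
      \<comment> \<open>Arcs leaving \<open>S\<close> never enter \<open>W\<close>, so the
        restriction to the outside of \<open>W\<close> keeps them all; the same holds for arcs
        entering \<open>R\<close>.\<close>
      show "(U - W) \<inter> S - Domain N \<subseteq> U - Domain (path_arcs ps)"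
        using S_W by (auto simp: N_def A_def[symmetric])
      show "(U - W) \<inter> R - Range N \<subseteq> U - Range (path_arcs ps)"
        using W_R by (auto simp: N_def A_def[symmetric])
      show "X' \<subseteq> W" by (simp add: X'_def)
      show "D \<subseteq> E" "D \<subseteq> X' \<times> X'" using D(1) A'E forest'(4) by (auto simp: X'_def)
      have "D \<subseteq> A'" using D(1) by blast
      then show "single_valued D" "single_valued (D\<inverse>)" "acyclic D"
        by (rule linear_forest_subset[OF forest'(1-3), of D])+
      \<comment> \<open>By \<open>gt\<close> and \<open>cW\<close> the subtraction in
        \<open>d\<close> does not truncate.\<close>
      show "card X' = card D + card (N \<inter> S \<times> R) + card ((U - W) \<inter> B) + k"
        unfolding NSR UB using D(2) gt cW by (simp add: d_def)
    qed
    then show False using gt by simp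
  next
    case False
    have "count_in W p \<le> count_in (W \<times> W) (vwalk_arcs p) + count_in (S \<times> R) (vwalk_arcs p)
           + count_in B p + 1" if p: "p \<in> set ps'" for p
    proof -
      have "p \<noteq> []" "set p \<subseteq> V" "set (vwalk_arcs p) \<subseteq> E"
        using ps'(1) p by (auto simp: path_system_def path_arcs_def)
      from blocks_le[OF W_nonempty this] show ?thesis by (simp split: if_splits)
    qed
    then have "(\<Sum>p\<leftarrow>ps'. count_in W p) \<le> (\<Sum>p\<leftarrow>ps'. count_in (W \<times> W) (vwalk_arcs p)
      + count_in (S \<times> R) (vwalk_arcs p) + count_in B p + 1)"
      by (intro sum_list_mono)
    then have "card X' \<le> card (A' \<inter> W \<times> W) + card (A' \<inter> S \<times> R) + card (set (concat ps') \<inter> B) + k"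
      unfolding card_concat_Int[OF dps'] card_path_arcs_Int[OF dps'] X'_def A'_def
        sum_list_addf sum_list_triv ps'(2) by simp
    \<comment> \<open>As \<open>ps\<close> covers all of \<open>B\<close>, the excess of subpaths in
      \<open>ps'\<close> must come from arcs from \<open>S\<close> to \<open>R\<close>.\<close>
    moreover have "card (set (concat ps') \<inter> B) \<le> card (U \<inter> B)"
      using B_subset by (intro card_mono) auto
    ultimately have lt: "card (A \<inter> S \<times> R) < card (A' \<inter> S \<times> R)" using False by linarith
    txt \<open>
      Enlarge the matching of arcs from \<open>S\<close> to \<open>R\<close>, cutting the paths after \<open>a\<close> and before \<open>b\<close>;
      this makes room for \<open>x\<close> as one more subpath inside \<open>W\<close>.
    \<close>
    define M where "M = A \<inter> S \<times> R"
    define M' where "M' = A' \<inter> S \<times> R"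
    have svM: "single_valued M" "single_valued (M\<inverse>)" "single_valued M'" "single_valued (M'\<inverse>)"
      using linear_forest_subset(1,2)[OF forest(1-3), of M] linear_forest_subset(1,2)[OF forest'(1-3), of M']
      by (simp_all add: M_def M'_def)
    obtain L a b where L: "L \<subseteq> M \<union> M'" "single_valued L" "single_valued (L\<inverse>)"
      "Domain L = insert a (Domain M)" "Range L = insert b (Range M)"
      "a \<in> Domain M' - Domain M" "b \<in> Range M' - Range M"
      using augment_matching[of M M'] lt svM finA unfolding M_def M'_def by blast
    have aS: "a \<in> S" and bR: "b \<in> R" using L(6,7) by (auto simp: M'_def)
    have LSR: "L \<subseteq> S \<times> R" and LE: "L \<subseteq> E" using L(1) AE A'E by (auto simp: M_def M'_def)
    \<comment> \<open>\<open>L\<close> replaces the old arcs from \<open>S\<close> to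
      \<open>R\<close>. The arcs leaving \<open>a\<close> or entering \<open>b\<close> are dropped
      as well, since \<open>L\<close> now uses these ends.\<close>
    define K where "K = {(y, z) \<in> N. (y, z) \<notin> S \<times> R \<and> y \<noteq> a \<and> z \<noteq> b}"
    define N' where "N' = insert a (insert b (U - W))"
    have KN: "K \<subseteq> N" and KA: "K \<subseteq> A" by (auto simp: K_def N_def)
    have dom: "Domain K \<inter> Domain L = {}"
    proof -
      have "y \<notin> Domain M" if "(y, z) \<in> K" for y z
        using that single_valuedD[OF forest(1)] KA unfolding K_def M_def by blast
      then show ?thesis unfolding L(4) by (auto simp: K_def)
    qed
    have ran: "Range K \<inter> Range L = {}"
    proof -
      have "z \<notin> Range M" if "(y, z) \<in> K" for y z
        using that single_valuedD[OF forest(2)] KA unfolding K_def M_def by blast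
      then show ?thesis unfolding L(5) by (auto simp: K_def)
    qed
    \<comment> \<open>Inside \<open>W\<close>, \<open>x\<close> becomes a piece of its own; outside,
      \<open>L\<close> has one arc more than \<open>M\<close>. Both sides of the required equation
      grow by one.\<close>
    have "card (insert x (U \<inter> W)) \<le> card (U \<inter> W)"
    proof (rule card_replacement_le[of "K \<union> L" N' "insert x (U \<inter> W)" "A \<inter> W \<times> W"])
      show "K \<union> L \<subseteq> E" using KA AE LE by blast
      have "K \<subseteq> N' \<times> N'" using AU by (auto simp: K_def N_def N'_def)
      moreover have "Domain L \<subseteq> N'" "Range L \<subseteq> N'"
        unfolding L(4,5) N'_def using AU SR by (auto simp: M_def)
      ultimately show "K \<union> L \<subseteq> N' \<times> N'" by auto
      have "single_valued K" "single_valued (K\<inverse>)"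
        by (rule linear_forest_subset[OF forest(1-3) KA])+
      then show "single_valued (K \<union> L)" "single_valued ((K \<union> L)\<inverse>)"
        using single_valued_Un_disjoint[OF _ L(2) dom]
          single_valued_Un_disjoint[OF _ L(3), of "K\<inverse>"] ran by (simp_all add: converse_Un)
      show "acyclic (K \<union> L)"
      \<comment> \<open>The levels put \<open>S\<close> below \<open>R\<close> and all other
        vertices between them. Arcs of \<open>L\<close> rise from \<open>S\<close> to
        \<open>R\<close>; an arc of \<open>K\<close> leaves \<open>S\<close> or enters
        \<open>R\<close>, so it rises or stays on its level, and it belongs to
        \<open>A\<close>.\<close>
      proof (rule acyclic_level[OF forest(3), where lev = "\<lambda>v. if v \<in> S then 0 else if v \<in> R then 2 else 1"])
        fix y z assume "(y, z) \<in> K \<union> L"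
        then consider "(y, z) \<in> K" | "y \<in> S" "z \<in> R" using LSR by blast
        then show "(if y \<in> S then 0 else if y \<in> R then 2 else 1) < (if z \<in> S then 0 else if z \<in> R then 2 else (1::nat))
          \<or> (if y \<in> S then 0 else if y \<in> R then 2 else 1) = (if z \<in> S then 0 else if z \<in> R then 2 else (1::nat)) \<and> (y, z) \<in> A"
        proof cases
          case 1
          then have yz: "(y, z) \<in> A" "y \<notin> W" "z \<notin> W" by (auto simp: K_def N_def)
          then have "y \<in> S \<or> z \<in> R" using A_class by blast
          then show ?thesis using yz SR(3) by auto
        next
          case 2
          then show ?thesis using SR(3) by auto
        qed
      qed
      show "U - W \<subseteq> N'" by (auto simp: N'_def)
      show "N' \<subseteq> V - W" using aS bR SR U_subset by (auto simp: N'_def)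
      show "y \<in> S \<or> z \<in> R" if "(y, z) \<in> K \<union> L" for y z
        using that A_class LSR by (auto simp: K_def N_def)
      show "N' \<inter> S - Domain (K \<union> L) \<subseteq> U - Domain (path_arcs ps)"
      proof
        fix y assume y: "y \<in> N' \<inter> S - Domain (K \<union> L)"
        \<comment> \<open>Such a \<open>y\<close> is not a tail of \<open>L\<close>, so any arc of
          the old system leaving it avoids \<open>R\<close> and would have survived in
          \<open>K\<close>.\<close>
        then have "y \<noteq> a" "y \<notin> Domain M" "y \<in> S" "y \<noteq> b" using L(4) bR SR(3) by auto
        then have "y \<in> U" using y by (auto simp: N'_def)
        moreover have "y \<notin> Domain A"
        proof
          assume "y \<in> Domain A"
          then obtain z where z: "(y, z) \<in> A" by blast
          then have "z \<notin> R" using \<open>y \<in> S\<close> \<open>y \<notin> Domain M\<close> by (auto simp: M_def)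
          then have "(y, z) \<in> K"
            using z S_W[OF z \<open>y \<in> S\<close>] \<open>y \<in> S\<close> \<open>y \<noteq> a\<close> bR SR(1) by (auto simp: K_def N_def)
          then show False using y by blast
        qed
        ultimately show "y \<in> U - Domain (path_arcs ps)" by (simp add: A_def)
      qed
      show "N' \<inter> R - Range (K \<union> L) \<subseteq> U - Range (path_arcs ps)"
      proof
        fix z assume z: "z \<in> N' \<inter> R - Range (K \<union> L)"
        then have "z \<noteq> b" "z \<notin> Range M" "z \<in> R" "z \<noteq> a" using L(5) aS SR(3) by auto
        then have "z \<in> U" using z by (auto simp: N'_def)
        moreover have "z \<notin> Range A"
        proof
          assume "z \<in> Range A"
          then obtain y where y: "(y, z) \<in> A" by blast
          then have "y \<notin> S" using \<open>z \<in> R\<close> \<open>z \<notin> Range M\<close> by (auto simp: M_def)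
          then have "(y, z) \<in> K"
            using y W_R[OF y \<open>z \<in> R\<close>] \<open>z \<in> R\<close> \<open>z \<noteq> b\<close> aS SR(2) by (auto simp: K_def N_def)
          then show False using z by blast
        qed
        ultimately show "z \<in> U - Range (path_arcs ps)" by (simp add: A_def)
      qed
      show "insert x (U \<inter> W) \<subseteq> W" using x_W by simp
      show "A \<inter> W \<times> W \<subseteq> E" "A \<inter> W \<times> W \<subseteq> insert x (U \<inter> W) \<times> insert x (U \<inter> W)"
        using AE AU by auto
      show "single_valued (A \<inter> W \<times> W)" "single_valued ((A \<inter> W \<times> W)\<inverse>)" "acyclic (A \<inter> W \<times> W)"
        using linear_forest_subset[OF forest(1-3), of "A \<inter> W \<times> W"] by simp_all
      have "(K \<union> L) \<inter> S \<times> R = L" using LSR by (auto simp: K_def)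
      moreover have "card L = Suc (card M)"
        using card_Domain_single_valued[OF L(2)] card_Domain_single_valued[OF svM(1)] L(4,6) finA
        by (simp add: M_def finite_Domain)
      moreover have "N' \<inter> B = U \<inter> B" using aS bR by (auto simp: N'_def B_def)
      moreover have "card (insert x (U \<inter> W)) = Suc (card (U \<inter> W))" using x_uncovered by simp
      ultimately show "card (insert x (U \<inter> W))
          = card (A \<inter> W \<times> W) + card ((K \<union> L) \<inter> S \<times> R) + card (N' \<inter> B) + k"
        using cW by (simp add: M_def)
    qed
    then show False using x_uncovered by simp
  qed
qed

end

text \<open>A fully covered \<open>W\<close> cannot be surpassed; otherwise an uncovered vertex of
  \<open>W\<close> serves as \<open>x\<close> in the preceding analysis.\<close>

lemma (in adjacent_module) maximum_system_covers_max:
  assumes "path_system V E ps" "length ps = k" "k \<ge> 1"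
    and "\<And>qs. path_system V E qs \<Longrightarrow> length qs = k \<Longrightarrow> card (set (concat qs)) \<le> card (set (concat ps))"
    and "path_system V E ps'" "length ps' = k"
  shows "card (set (concat ps') \<inter> W) \<le> card (set (concat ps) \<inter> W)"
proof (cases "W \<subseteq> set (concat ps)")
  case True
  then show ?thesis by (intro card_mono) auto
next
  case False
  then obtain x where x: "x \<in> W" "x \<notin> set (concat ps)" by blast
  interpret unsaturated_maximum_system V E W ps k x
    using assms x by unfold_locales auto
  show ?thesis using assms(5,6) by (rule covers_max)
qed

subsection \<open>Semicomplete compositions\<close>

lemma path_system_of_k_path_subdigraph:
  assumes "k_path_subdigraph k D P"
  obtains ps where "path_system (pverts D) (parcs D) ps" "length ps = k" "set (concat ps) = covered P"
proof -
  have P: "finite P" "card P = k" "\<And>p. p \<in> P \<Longrightarrow> vpath p (with_proj D)"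
    "pairwise (\<lambda>p q. disjnt (set p) (set q)) P"
    using assms by (auto simp: k_path_subdigraph_def)
  obtain ps where ps: "set ps = P" "distinct ps" using finite_distinct_list[OF P(1)] by blast
  have "distinct (concat ps)"
    using P(3,4) ps by (intro distinct_concat) (auto simp: vpath_def pairwise_def disjnt_def)
  moreover have "[] \<notin> set ps" "set (concat ps) \<subseteq> pverts D" "path_arcs ps \<subseteq> parcs D"
    using P(3) ps(1) by (fastforce simp: vpath_def vwalk_def path_arcs_def)+
  moreover have "length ps = k" using ps P(2) distinct_card by fastforce
  ultimately show ?thesis using that[of ps] ps(1) by (simp add: path_system_def covered_def)
qed

lemma k_path_subdigraph_of_path_system:
  assumes "path_system (pverts D) (parcs D) ps"
  shows "k_path_subdigraph (length ps) D (set ps)" "covered (set ps) = set (concat ps)"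
proof -
  have "distinct ps" "\<forall>p\<in>set ps. distinct p"
      "\<forall>p\<in>set ps. \<forall>q\<in>set ps. p \<noteq> q \<longrightarrow> set p \<inter> set q = {}"
    using assms by (auto simp: path_system_def distinct_concat_iff removeAll_id)
  moreover have "\<forall>p\<in>set ps. p \<noteq> [] \<and> set p \<subseteq> pverts D \<and> set (vwalk_arcs p) \<subseteq> parcs D"
    using assms by (auto simp: path_system_def path_arcs_def)
  ultimately show "k_path_subdigraph (length ps) D (set ps)"
    by (auto simp: k_path_subdigraph_def vpath_def vwalk_def pairwise_def disjnt_def distinct_card)
qed (simp add: covered_def)

text \<open>Arcs inside a part never join different parts, so between parts only the indices matter;
  this gives both module conditions. Adjacency comes from the semicompleteness of
  \<open>T\<close>.\<close>

lemma composition_adjacent_module: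
  assumes "bij_betw u {1..t} (pverts T)" "\<forall>i\<in>{1..t}. pair_digraph (H i)"
    and "disjoint_family_on (\<lambda>i. pverts (H i)) {1..t}" "semicomplete T" "i \<in> {1..t}"
  shows "adjacent_module (pverts (composition T u t H)) (parcs (composition T u t H)) (pverts (H i))"
proof -
  let ?V = "pverts (composition T u t H)" and ?E = "parcs (composition T u t H)"
  let ?W = "pverts (H i)"
  have V: "?V = (\<Union>j\<in>{1..t}. pverts (H j))" by (simp add: composition_def)
  have uniq: "j = j'" if "v \<in> pverts (H j)" "v \<in> pverts (H j')" "j \<in> {1..t}" "j' \<in> {1..t}" for v j j'
    using assms(3) that unfolding disjoint_family_on_def by blast
  have wf: "a \<in> pverts (H j) \<and> b \<in> pverts (H j)" if "(a, b) \<in> parcs (H j)" "j \<in> {1..t}" for a b j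
  proof -
    interpret pair_digraph "H j" using assms(2) that(2) by blast
    show ?thesis using in_arcsD1 in_arcsD2 that(1) by blast
  qed
  have arc: "(a, b) \<in> ?E \<longleftrightarrow> (u j, u p) \<in> parcs T"
    if "a \<in> pverts (H j)" "b \<in> pverts (H p)" "j \<in> {1..t}" "p \<in> {1..t}" "j \<noteq> p" for a b j p
  proof
    assume "(a, b) \<in> ?E"
    then consider l where "l \<in> {1..t}" "(a, b) \<in> parcs (H l)"
      | l l' where "l \<in> {1..t}" "l' \<in> {1..t}" "a \<in> pverts (H l)" "b \<in> pverts (H l')" "(u l, u l') \<in> parcs T"
      unfolding composition_def by auto
    then show "(u j, u p) \<in> parcs T"
    proof cases
      case 1
      then show ?thesis using wf[of a b l] uniq[of a j l] uniq[of b p l] that by blast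
    next
      case 2
      then show ?thesis using uniq[of a j l] uniq[of b p l'] that by blast
    qed
  next
    assume "(u j, u p) \<in> parcs T"
    then show "(a, b) \<in> ?E" using that unfolding composition_def by auto
  qed
  have other: "\<exists>p\<in>{1..t}. p \<noteq> i \<and> z \<in> pverts (H p)" if "z \<in> ?V - ?W" for z
    using that V by auto
  show ?thesis
  proof
    show "finite ?V" unfolding V
    proof (rule finite_UN_I)
      fix j assume "j \<in> {1..t}"
      then interpret pair_digraph "H j" using assms(2) by blast
      show "finite (pverts (H j))" by (rule pair_finite_verts)
    qed simp
    show "?W \<subseteq> ?V" using V assms(5) by blast
  next
    fix w w' z assume "w \<in> ?W" "w' \<in> ?W" "z \<in> ?V - ?W"
    then show "(w, z) \<in> ?E \<Longrightarrow> (w', z) \<in> ?E" and "(z, w) \<in> ?E \<Longrightarrow> (z, w') \<in> ?E"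
      using other[of z] arc assms(5) by metis+
  next
    fix w z assume wz: "w \<in> ?W" "z \<in> ?V - ?W"
    then obtain p where p: "p \<in> {1..t}" "p \<noteq> i" "z \<in> pverts (H p)" using other by blast
    have "u i \<noteq> u p"
      using inj_on_eq_iff[OF bij_betw_imp_inj_on[OF assms(1)] assms(5) p(1)] p(2) by simp
    moreover have "u i \<in> pverts T" "u p \<in> pverts T"
      using bij_betwE[OF assms(1)] assms(5) p(1) by blast+
    ultimately have "(u i, u p) \<in> parcs T \<or> (u p, u i) \<in> parcs T"
      using assms(4) by (simp add: semicomplete_def)
    then show "(w, z) \<in> ?E \<or> (z, w) \<in> ?E"
      using arc[of w i z p] arc[of z p w i] wz p assms(5) by blast
  qed
qed

theorem theorem3p7:
  fixes T :: "'b pair_pre_digraph"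
    and u :: "nat \<Rightarrow> 'b"
    and H :: "nat \<Rightarrow> 'a pair_pre_digraph"
    and Q :: "'a pair_pre_digraph"
    and t n k :: nat
  assumes "pair_digraph T"
    and "2 \<le> t"
    and "bij_betw u {1..t} (pverts T)"
    and "\<forall>i\<in>{1..t}. pair_digraph (H i)"
    and "\<forall>i\<in>{1..t}. pverts (H i) \<noteq> {}"
    and "disjoint_family_on (\<lambda>i. pverts (H i)) {1..t}"
    and "Q = composition T u t H"
    and "semicomplete T"
    and "strongly_connected (with_proj Q)"
    and "card (pverts Q) = n"
    and "k \<in> {1..n}"
  shows "\<forall>P. maximum_k_path_subdigraph k Q P \<longrightarrow>
    (\<forall>i\<in>{1..t}. card (covered P \<inter> pverts (H i)) = max_cover k Q (pverts (H i)))"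
proof (intro allI impI ballI)
  fix P i
  assume max: "maximum_k_path_subdigraph k Q P" and i: "i \<in> {1..t}"
  interpret adjacent_module "pverts Q" "parcs Q" "pverts (H i)"
    using composition_adjacent_module[OF assms(3,4,6,8) i] assms(7) by simp
  have P: "k_path_subdigraph k Q P"
    "\<And>P'. k_path_subdigraph k Q P' \<Longrightarrow> card (covered P') \<le> card (covered P)"
    using max by (auto simp: maximum_k_path_subdigraph_def)
  obtain ps where ps: "path_system (pverts Q) (parcs Q) ps" "length ps = k" "set (concat ps) = covered P"
    using P(1) by (rule path_system_of_k_path_subdigraph)
  have ps_max: "card (set (concat qs)) \<le> card (set (concat ps))"
    if "path_system (pverts Q) (parcs Q) qs" "length qs = k" for qs
    using P(2)[of "set qs"] k_path_subdigraph_of_path_system[OF that(1)] that(2) ps(3) by simp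
  have "card (covered P' \<inter> pverts (H i)) \<le> card (covered P \<inter> pverts (H i))"
    if P': "k_path_subdigraph k Q P'" for P'
  proof -
    obtain ps' where "path_system (pverts Q) (parcs Q) ps'" "length ps' = k" "set (concat ps') = covered P'"
      by (rule path_system_of_k_path_subdigraph[OF P'])
    then show ?thesis
      using maximum_system_covers_max[OF ps(1,2) _ ps_max] ps(3) assms(11) by force
  qed
  then show "card (covered P \<inter> pverts (H i)) = max_cover k Q (pverts (H i))"
    unfolding max_cover_def
    using P(1) finite_max_cover_set[OF finite_V] by (intro Max_eqI[symmetric]) auto
qed

end
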